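(* Let $\mathcal{C}$ and $\mathcal{D}$ be categories. (1) A functor $G:\mathcal{D}\to\mathcal{C}$ is a coreflection up to retracts if and only if it is part of a semiadjunction $(F,G,\eta,\epsilon)$ and there is a natural transformation $\nu:GF\to\mathrm{Id}_{\mathcal{C}}$ such that $\eta\circ\nu=GF\mathrm{Id}$ and $\nu\circ\eta=\mathrm{Id}_{\mathrm{Id}_{\mathcal{C}}}$. (2) A functor $F:\mathcal{C}\to\mathcal{D}$ is a reflection up to retracts if and only if it is part of a semiadjunction $(F,G,\eta,\epsilon)$ and there is a natural transformation $\gamma:\mathrm{Id}_{\mathcal{D}}\to FG$ such that $\gamma\circ\epsilon=FG\mathrm{Id}$ and $\epsilon\circ\gamma=\mathrm{Id}_{\mathrm{Id}_{\mathcal{D}}}$.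
   Context: A semifunctor is defined in the same way as a functor except that it need not preserve identities. For semifunctors $F,F':\mathcal{C}\to\mathcal{D}$, a natural transformation $\alpha:F\to F'$ is a family of morphisms $\alpha_C:FC\to F'C$ with $\alpha_D\circ Ff=F'f\circ\alpha_C$ for every $f:C\to D$ in $\mathcal{C}$. For a semifunctor $F$, $F\mathrm{Id}:F\to F$ denotes the natural transformation with components $F(\mathrm{Id}_C)$; so $GF\mathrm{Id}$ has components $GF(\mathrm{Id}_C)$. A semiadjunction $(F,G,\eta,\epsilon)$ consists of semifunctors $F:\mathcal{C}\to\mathcal{D}$, $G:\mathcal{D}\to\mathcal{C}$ and natural transformations $\eta:\mathrm{Id}_{\mathcal{C}}\to GF$ and $\epsilon:FG\to\mathrm{Id}_{\mathcal{D}}$ such that $G\epsilon\circ\eta G=G\mathrm{Id}$ and $\epsilon F\circ F\eta=F\mathrm{Id}$. The idempotent completion $\mathcal{C}^\natural$ of a category $\mathcal{C}$ has as objects the pairs $(X,e)$ with $X$ an object of $\mathcal{C}$ and $e:X\to X$ idempotent; a morphism $f:(X,e)\to(X',e')$ is a morphism $f:X\to X'$ in $\mathcal{C}$ with $f=e'\circ f\circ e$; composition is that of $\mathcal{C}$ and $\mathrm{Id}_{(X,e)}=e$. A functor $F:\mathcal{C}\to\mathcal{D}$ induces its completion $F^\natural:\mathcal{C}^\natural\to\mathcal{D}^\natural$, $F^\natural(X,e)=(FX,Fe)$, $F^\natural(f)=F(f)$. A reflection (resp. coreflection) is a functor admitting a fully faithful right (resp. left) adjoint. A functor $F$ is a reflection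 (resp. coreflection) up to retracts if $F^\natural$ is a reflection (resp. coreflection). *)

theory Defs
  imports Main
begin

text \<open>Every arrow determines its domain and codomain, so hom-sets are pairwise disjoint.
  All structure is relative to the carriers \<open>Obj\<close> and \<open>Arr\<close>; values elsewhere are junk.\<close>

record ('o, 'a) category =
  Obj :: "'o set"
  Arr :: "'a set"
  Dom :: "'a \<Rightarrow> 'o"
  Cod :: "'a \<Rightarrow> 'o"
  Ide :: "'o \<Rightarrow> 'a"
  Comp :: "'a \<Rightarrow> 'a \<Rightarrow> 'a"  (infixl \<open>\<cdot>\<index>\<close> 70)

definition hom :: "('o, 'a, 'm) category_scheme \<Rightarrow> 'o \<Rightarrow> 'o \<Rightarrow> 'a set" where
  "hom C X Y = {f \<in> Arr C. Dom C f = X \<and> Cod C f = Y}"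

locale category =
  fixes C :: "('o, 'a, 'm) category_scheme" (structure)
  assumes Dom_Obj: "f \<in> Arr C \<Longrightarrow> Dom C f \<in> Obj C"
    and Cod_Obj: "f \<in> Arr C \<Longrightarrow> Cod C f \<in> Obj C"
    and Ide_hom: "X \<in> Obj C \<Longrightarrow> Ide C X \<in> hom C X X"
    and Comp_hom: "f \<in> hom C X Y \<Longrightarrow> g \<in> hom C Y Z \<Longrightarrow> g \<cdot> f \<in> hom C X Z"
    and Comp_Ide: "f \<in> hom C X Y \<Longrightarrow> f \<cdot> Ide C X = f"
    and Ide_Comp: "f \<in> hom C X Y \<Longrightarrow> Ide C Y \<cdot> f = f"
    and Comp_assoc: "f \<in> hom C W X \<Longrightarrow> g \<in> hom C X Y \<Longrightarrow> h \<in> hom C Y Z \<Longrightarrow>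
      (h \<cdot> g) \<cdot> f = h \<cdot> (g \<cdot> f)"

record ('o, 'a, 'p, 'b) semifunctor_data =
  OMap :: "'o \<Rightarrow> 'p"
  AMap :: "'a \<Rightarrow> 'b"

definition is_semifunctor ::
    "('o, 'a) category \<Rightarrow> ('p, 'b) category \<Rightarrow> ('o, 'a, 'p, 'b) semifunctor_data \<Rightarrow> bool" where
  "is_semifunctor C D F \<longleftrightarrow>
    (\<forall>X \<in> Obj C. OMap F X \<in> Obj D) \<and>
    (\<forall>X \<in> Obj C. \<forall>Y \<in> Obj C. \<forall>f \<in> hom C X Y. AMap F f \<in> hom D (OMap F X) (OMap F Y)) \<and>
    (\<forall>X \<in> Obj C. \<forall>Y \<in> Obj C. \<forall>Z \<in> Obj C. \<forall>f \<in> hom C X Y. \<forall>g \<in> hom C Y Z.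
      AMap F (g \<cdot>\<^bsub>C\<^esub> f) = AMap F g \<cdot>\<^bsub>D\<^esub> AMap F f)"

definition is_functor ::
    "('o, 'a) category \<Rightarrow> ('p, 'b) category \<Rightarrow> ('o, 'a, 'p, 'b) semifunctor_data \<Rightarrow> bool" where
  "is_functor C D F \<longleftrightarrow> is_semifunctor C D F \<and>
    (\<forall>X \<in> Obj C. AMap F (Ide C X) = Ide D (OMap F X))"

definition id_functor :: "('o, 'a, 'o, 'a) semifunctor_data" where
  "id_functor = \<lparr>OMap = (\<lambda>X. X), AMap = (\<lambda>f. f)\<rparr>"

definition comp_functor ::
    "('p, 'b, 'q, 'c) semifunctor_data \<Rightarrow> ('o, 'a, 'p, 'b) semifunctor_data \<Rightarrow>
      ('o, 'a, 'q, 'c) semifunctor_data"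
    (infixl \<open>\<odot>\<close> 75) where
  "G \<odot> F = \<lparr>OMap = (\<lambda>X. OMap G (OMap F X)), AMap = (\<lambda>f. AMap G (AMap F f))\<rparr>"

definition nat_trans ::
    "('o, 'a) category \<Rightarrow> ('p, 'b) category \<Rightarrow> ('o, 'a, 'p, 'b) semifunctor_data \<Rightarrow>
      ('o, 'a, 'p, 'b) semifunctor_data \<Rightarrow> ('o \<Rightarrow> 'b) \<Rightarrow> bool" where
  "nat_trans C D F F' \<alpha> \<longleftrightarrow>
    (\<forall>X \<in> Obj C. \<alpha> X \<in> hom D (OMap F X) (OMap F' X)) \<and>
    (\<forall>X \<in> Obj C. \<forall>Y \<in> Obj C. \<forall>f \<in> hom C X Y.
      \<alpha> Y \<cdot>\<^bsub>D\<^esub> AMap F f = AMap F' f \<cdot>\<^bsub>D\<^esub> \<alpha> X)"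

definition semiadjunction ::
    "('o, 'a) category \<Rightarrow> ('p, 'b) category \<Rightarrow> ('o, 'a, 'p, 'b) semifunctor_data \<Rightarrow>
      ('p, 'b, 'o, 'a) semifunctor_data \<Rightarrow> ('o \<Rightarrow> 'a) \<Rightarrow> ('p \<Rightarrow> 'b) \<Rightarrow> bool" where
  "semiadjunction C D F G \<eta> \<epsilon> \<longleftrightarrow>
    is_semifunctor C D F \<and> is_semifunctor D C G \<and>
    nat_trans C C id_functor (G \<odot> F) \<eta> \<and> nat_trans D D (F \<odot> G) id_functor \<epsilon> \<and>
    (\<forall>Y \<in> Obj D. AMap G (\<epsilon> Y) \<cdot>\<^bsub>C\<^esub> \<eta> (OMap G Y) = AMap G (Ide D Y)) \<and>
    (\<forall>X \<in> Obj C. \<epsilon> (OMap F X) \<cdot>\<^bsub>D\<^esub> AMap F (\<eta> X) = AMap F (Ide C X))"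

definition adjunction ::
    "('o, 'a) category \<Rightarrow> ('p, 'b) category \<Rightarrow> ('o, 'a, 'p, 'b) semifunctor_data \<Rightarrow>
      ('p, 'b, 'o, 'a) semifunctor_data \<Rightarrow> ('o \<Rightarrow> 'a) \<Rightarrow> ('p \<Rightarrow> 'b) \<Rightarrow> bool" where
  "adjunction C D F G \<eta> \<epsilon> \<longleftrightarrow>
    is_functor C D F \<and> is_functor D C G \<and>
    nat_trans C C id_functor (G \<odot> F) \<eta> \<and> nat_trans D D (F \<odot> G) id_functor \<epsilon> \<and>
    (\<forall>Y \<in> Obj D. AMap G (\<epsilon> Y) \<cdot>\<^bsub>C\<^esub> \<eta> (OMap G Y) = Ide C (OMap G Y)) \<and>
    (\<forall>X \<in> Obj C. \<epsilon> (OMap F X) \<cdot>\<^bsub>D\<^esub> AMap F (\<eta> X) = Ide D (OMap F X))"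

definition fully_faithful ::
    "('o, 'a) category \<Rightarrow> ('p, 'b) category \<Rightarrow> ('o, 'a, 'p, 'b) semifunctor_data \<Rightarrow> bool" where
  "fully_faithful C D F \<longleftrightarrow> (\<forall>X \<in> Obj C. \<forall>Y \<in> Obj C.
    bij_betw (AMap F) (hom C X Y) (hom D (OMap F X) (OMap F Y)))"

definition reflection ::
    "('o, 'a) category \<Rightarrow> ('p, 'b) category \<Rightarrow> ('o, 'a, 'p, 'b) semifunctor_data \<Rightarrow> bool" where
  "reflection C D F \<longleftrightarrow> is_functor C D F \<and>
    (\<exists>G \<eta> \<epsilon>. adjunction C D F G \<eta> \<epsilon> \<and> fully_faithful D C G)"

definition coreflection ::
    "('p, 'b) category \<Rightarrow> ('o, 'a) category \<Rightarrow> ('p, 'b, 'o, 'a) semifunctor_data \<Rightarrow> bool" where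
  "coreflection D C G \<longleftrightarrow> is_functor D C G \<and>
    (\<exists>F \<eta> \<epsilon>. adjunction C D F G \<eta> \<epsilon> \<and> fully_faithful C D F)"

text \<open>A morphism \<open>f : (X, e) \<rightarrow> (X', e')\<close> of the idempotent completion is encoded as the triple
  \<open>((X, e), f, (X', e'))\<close>, because the same \<open>f\<close> can be a morphism between several pairs of objects.\<close>

definition completion_objs :: "('o, 'a) category \<Rightarrow> ('o \<times> 'a) set" where
  "completion_objs C = {(X, e). X \<in> Obj C \<and> e \<in> hom C X X \<and> e \<cdot>\<^bsub>C\<^esub> e = e}"

definition completion ::
    "('o, 'a) category \<Rightarrow> ('o \<times> 'a, ('o \<times> 'a) \<times> 'a \<times> ('o \<times> 'a)) category" where
  "completion C =
    \<lparr>Obj = completion_objs C,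
     Arr = {(A, f, B). A \<in> completion_objs C \<and> B \<in> completion_objs C \<and>
       f \<in> hom C (fst A) (fst B) \<and> f = snd B \<cdot>\<^bsub>C\<^esub> f \<cdot>\<^bsub>C\<^esub> snd A},
     Dom = (\<lambda>(A, f, B). A),
     Cod = (\<lambda>(A, f, B). B),
     Ide = (\<lambda>A. (A, snd A, A)),
     Comp = (\<lambda>(_, g, B') (A, f, _). (A, g \<cdot>\<^bsub>C\<^esub> f, B'))\<rparr>"

definition completion_obj :: "('o, 'a, 'p, 'b) semifunctor_data \<Rightarrow> 'o \<times> 'a \<Rightarrow> 'p \<times> 'b" where
  "completion_obj F = (\<lambda>(X, e). (OMap F X, AMap F e))"

definition functor_completion ::
    "('o, 'a, 'p, 'b) semifunctor_data \<Rightarrow>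
      ('o \<times> 'a, ('o \<times> 'a) \<times> 'a \<times> ('o \<times> 'a), 'p \<times> 'b, ('p \<times> 'b) \<times> 'b \<times> ('p \<times> 'b)) semifunctor_data" where
  "functor_completion F =
    \<lparr>OMap = completion_obj F,
     AMap = (\<lambda>(A, f, B). (completion_obj F A, AMap F f, completion_obj F B))\<rparr>"

definition reflection_up_to_retracts ::
    "('o, 'a) category \<Rightarrow> ('p, 'b) category \<Rightarrow> ('o, 'a, 'p, 'b) semifunctor_data \<Rightarrow> bool" where
  "reflection_up_to_retracts C D F \<longleftrightarrow>
    is_functor C D F \<and> reflection (completion C) (completion D) (functor_completion F)"

definition coreflection_up_to_retracts ::
    "('p, 'b) category \<Rightarrow> ('o, 'a) category \<Rightarrow> ('p, 'b, 'o, 'a) semifunctor_data \<Rightarrow> bool" where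
  "coreflection_up_to_retracts D C G \<longleftrightarrow>
    is_functor D C G \<and> coreflection (completion D) (completion C) (functor_completion G)"

lemma hom_completion:
  "f \<in> hom (completion C) A B \<longleftrightarrow> (\<exists>f0. f = (A, f0, B) \<and> A \<in> completion_objs C \<and>
    B \<in> completion_objs C \<and> f0 \<in> hom C (fst A) (fst B) \<and> snd B \<cdot>\<^bsub>C\<^esub> f0 \<cdot>\<^bsub>C\<^esub> snd A = f0)"
  unfolding hom_def[of "completion C"] by (cases f) (auto simp: completion_def)

lemma completion_objs_iff:
  "A \<in> completion_objs C \<longleftrightarrow>
    fst A \<in> Obj C \<and> snd A \<in> hom C (fst A) (fst A) \<and> snd A \<cdot>\<^bsub>C\<^esub> snd A = snd A"
  by (auto simp: completion_objs_def)

lemma category_completion: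
  assumes "category C"
  shows "category (completion C)"
proof -
  interpret category C by fact
  have absorb: "f \<cdot>\<^bsub>C\<^esub> snd A = f \<and> snd B \<cdot>\<^bsub>C\<^esub> f = f"
    if A: "A \<in> completion_objs C" and B: "B \<in> completion_objs C"
      and f: "f \<in> hom C (fst A) (fst B)" and eq: "snd B \<cdot>\<^bsub>C\<^esub> f \<cdot>\<^bsub>C\<^esub> snd A = f" for A B f
  proof -
    note AB = A[unfolded completion_objs_iff] B[unfolded completion_objs_iff]
    have Bf: "snd B \<cdot>\<^bsub>C\<^esub> f \<in> hom C (fst A) (fst B)"
      using f AB by (blast intro: Comp_hom)
    have "f \<cdot>\<^bsub>C\<^esub> snd A = (snd B \<cdot>\<^bsub>C\<^esub> f \<cdot>\<^bsub>C\<^esub> snd A) \<cdot>\<^bsub>C\<^esub> snd A"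
      by (simp only: eq)
    also have "\<dots> = f"
      using AB Comp_assoc[of "snd A" "fst A" "fst A" "snd A" "fst A" "snd B \<cdot>\<^bsub>C\<^esub> f" "fst B"] Bf eq
      by simp
    finally have 1: "f \<cdot>\<^bsub>C\<^esub> snd A = f" .
    then have 2: "snd B \<cdot>\<^bsub>C\<^esub> f = f"
      using AB f eq Comp_assoc[of "snd A" "fst A" "fst A" f "fst B" "snd B" "fst B"] by simp
    from 1 2 show ?thesis by simp
  qed
  show ?thesis
  proof
    fix f X Y g Z
    assume "f \<in> hom (completion C) X Y" "g \<in> hom (completion C) Y Z"
    then obtain f0 g0 where fg: "f = (X, f0, Y)" "g = (Y, g0, Z)"
      and obj: "X \<in> completion_objs C" "Y \<in> completion_objs C" "Z \<in> completion_objs C"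
      and f0: "f0 \<in> hom C (fst X) (fst Y)" "snd Y \<cdot>\<^bsub>C\<^esub> f0 \<cdot>\<^bsub>C\<^esub> snd X = f0"
      and g0: "g0 \<in> hom C (fst Y) (fst Z)" "snd Z \<cdot>\<^bsub>C\<^esub> g0 \<cdot>\<^bsub>C\<^esub> snd Y = g0"
      unfolding hom_completion by blast
    note XZ = obj(1)[unfolded completion_objs_iff] obj(3)[unfolded completion_objs_iff]
    have gf: "g0 \<cdot>\<^bsub>C\<^esub> f0 \<in> hom C (fst X) (fst Z)"
      using f0(1) g0(1) by (rule Comp_hom)
    have "snd Z \<cdot>\<^bsub>C\<^esub> (g0 \<cdot>\<^bsub>C\<^esub> f0) = g0 \<cdot>\<^bsub>C\<^esub> f0"
      using Comp_assoc[OF f0(1) g0(1), of "snd Z" "fst Z"] absorb[OF obj(2,3) g0] XZ by simp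
    moreover have "g0 \<cdot>\<^bsub>C\<^esub> f0 \<cdot>\<^bsub>C\<^esub> snd X = g0 \<cdot>\<^bsub>C\<^esub> f0"
      using Comp_assoc[OF _ f0(1) g0(1), of "snd X" "fst X"] absorb[OF obj(1,2) f0] XZ by simp
    ultimately show "Comp (completion C) g f \<in> hom (completion C) X Z"
      using obj gf by (simp add: hom_completion) (simp add: fg completion_def)
  next
    fix f X Y assume "f \<in> hom (completion C) X Y"
    then obtain f0 where f: "f = (X, f0, Y)" and "f0 \<cdot>\<^bsub>C\<^esub> snd X = f0 \<and> snd Y \<cdot>\<^bsub>C\<^esub> f0 = f0"
      unfolding hom_completion using absorb by blast
    then show "Comp (completion C) f (Ide (completion C) X) = f"
      "Comp (completion C) (Ide (completion C) Y) f = f"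
      by (simp_all add: completion_def)
  next
    fix f W X g Y h Z
    assume "f \<in> hom (completion C) W X" "g \<in> hom (completion C) X Y"
      "h \<in> hom (completion C) Y Z"
    then obtain f0 g0 h0 where "f = (W, f0, X)" "g = (X, g0, Y)" "h = (Y, h0, Z)"
      "f0 \<in> hom C (fst W) (fst X)" "g0 \<in> hom C (fst X) (fst Y)" "h0 \<in> hom C (fst Y) (fst Z)"
      unfolding hom_completion by blast
    then show "Comp (completion C) (Comp (completion C) h g) f =
        Comp (completion C) h (Comp (completion C) g f)"
      using Comp_assoc by (simp add: completion_def)
  next
    fix X assume "X \<in> Obj (completion C)"
    then have "X \<in> completion_objs C" by (simp add: completion_def)
    then show "Ide (completion C) X \<in> hom (completion C) X X"
      by (simp add: hom_completion) (simp add: completion_def completion_objs_iff)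
  next
    fix f assume "f \<in> Arr (completion C)"
    then have "f \<in> hom (completion C) (Dom (completion C) f) (Cod (completion C) f)"
      by (simp add: hom_def)
    then show "Dom (completion C) f \<in> Obj (completion C)" "Cod (completion C) f \<in> Obj (completion C)"
      unfolding hom_completion by (auto simp: completion_def)
  qed
qed

lemma is_functor_functor_completion:
  assumes "category C" "is_semifunctor C D F"
  shows "is_functor (completion C) (completion D) (functor_completion F)"
proof -
  interpret category C by fact
  note F = assms(2)[unfolded is_semifunctor_def]
  have mult: "AMap F (g \<cdot>\<^bsub>C\<^esub> f) = AMap F g \<cdot>\<^bsub>D\<^esub> AMap F f"
    if "f \<in> hom C X Y" "g \<in> hom C Y Z" for f g X Y Z
    using F that Dom_Obj Cod_Obj unfolding hom_def by blast
  have o: "completion_obj F A \<in> completion_objs D" if "A \<in> completion_objs C" for A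
  proof -
    note A = that[unfolded completion_objs_iff]
    then have "AMap F (snd A) \<cdot>\<^bsub>D\<^esub> AMap F (snd A) = AMap F (snd A \<cdot>\<^bsub>C\<^esub> snd A)"
      using F by metis
    with A F show ?thesis
      by (simp add: completion_objs_iff completion_obj_def split_beta)
  qed
  have h: "AMap (functor_completion F) f \<in>
      hom (completion D) (OMap (functor_completion F) A) (OMap (functor_completion F) B)"
    if fAB: "f \<in> hom (completion C) A B" for f A B
  proof -
    obtain f0 where f: "f = (A, f0, B)"
      and obj: "A \<in> completion_objs C" "B \<in> completion_objs C"
      and f0: "f0 \<in> hom C (fst A) (fst B)" "snd B \<cdot>\<^bsub>C\<^esub> f0 \<cdot>\<^bsub>C\<^esub> snd A = f0"
      using fAB unfolding hom_completion by blast
    note AB = obj[unfolded completion_objs_iff]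
    have "snd B \<cdot>\<^bsub>C\<^esub> f0 \<in> hom C (fst A) (fst B)"
      using f0 AB by (blast intro: Comp_hom)
    then have "AMap F (snd B \<cdot>\<^bsub>C\<^esub> f0 \<cdot>\<^bsub>C\<^esub> snd A) = AMap F (snd B) \<cdot>\<^bsub>D\<^esub> AMap F f0 \<cdot>\<^bsub>D\<^esub> AMap F (snd A)"
      using mult[of "snd A" "fst A" "fst A" "snd B \<cdot>\<^bsub>C\<^esub> f0" "fst B"] mult[of f0 "fst A" "fst B" "snd B" "fst B"]
        AB f0(1) by simp
    then have "AMap F (snd B) \<cdot>\<^bsub>D\<^esub> AMap F f0 \<cdot>\<^bsub>D\<^esub> AMap F (snd A) = AMap F f0"
      by (simp only: f0(2))
    moreover have "AMap F f0 \<in> hom D (OMap F (fst A)) (OMap F (fst B))"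
      using F AB f0(1) by simp
    ultimately show ?thesis
      using o[OF obj(1)] o[OF obj(2)]
      by (simp add: f hom_completion functor_completion_def)
        (simp add: completion_obj_def split_beta)
  qed
  have k: "AMap (functor_completion F) (Comp (completion C) g f) =
      Comp (completion D) (AMap (functor_completion F) g) (AMap (functor_completion F) f)"
    if fg: "f \<in> hom (completion C) A B" "g \<in> hom (completion C) B B'" for f g A B B'
  proof -
    obtain f0 g0 where "f = (A, f0, B)" "g = (B, g0, B')"
      "A \<in> completion_objs C" "B \<in> completion_objs C" "B' \<in> completion_objs C"
      "f0 \<in> hom C (fst A) (fst B)" "g0 \<in> hom C (fst B) (fst B')"
      using fg unfolding hom_completion by blast
    then show ?thesis
      using mult by (simp add: completion_def functor_completion_def)
  qed
  have "OMap (functor_completion F) A \<in> Obj (completion D)" if "A \<in> Obj (completion C)" for A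
    using o that by (simp add: completion_def functor_completion_def)
  moreover have "AMap (functor_completion F) (Ide (completion C) A) =
      Ide (completion D) (OMap (functor_completion F) A)" for A
    by (simp add: completion_def functor_completion_def completion_obj_def split_beta)
  ultimately show ?thesis
    unfolding is_functor_def is_semifunctor_def using h k by blast
qed

end

theory Submission
  imports Defs
begin

text \<open>The left adjoint of an adjunction is fully faithful exactly when the unit is invertible, and
  dually for the right adjoint and the counit. A semiadjunction extends to an adjunction of the completions by setting
  \<open>\<eta>(X, e) = \<eta> X \<cdot> e\<close>, and invertibility of unit or counit carries over. Conversely, an adjunction
  of \<open>L\<close> and \<open>R\<close> between the completions restricts to a semiadjunction through
  \<open>X \<mapsto> fst (L (X, Id))\<close>: every \<open>(Y, e)\<close> is a retract of \<open>(Y, Id)\<close>, and inserting these retractions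
  corrects the unit and the counit. The restriction of the completion of \<open>G\<close> is \<open>G\<close> itself.\<close>

section \<open>Calculating with arrows\<close>

text \<open>Semifunctors enter because of idempotents. If F is a semifunctor, F Id is idempotent
  without having to be an identity; in the completion, however, the identity of (FX, Fe) is Fe, so
  an equation with right-hand side F Id turns into one with a genuine identity. Conversely, a
  functor L between completions may send (X, Id) to some (Y, e) with e different from Id, and
  forgetting e leaves a semifunctor whose value at the identity of X is e. The obstacle is that
  forgetting does not commute with composition: a second functor R is then evaluated at (Y, Id)
  instead of (Y, e). The two results differ, and the comparison maps between them are inverse to
  each other only up to idempotents. Invertibility is therefore treated from the start in a form
  that allows F Id in place of identities.\<close>

lemma hom_iff: "f \<in> hom C X Y \<longleftrightarrow> f \<in> Arr C \<and> Dom C f = X \<and> Cod C f = Y"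
  by (auto simp: hom_def)

text \<open>The axioms of the locale mention source and target objects that do not occur in their
  conclusions, so the simplifier would have to guess them. With \<open>Dom\<close> and
  \<open>Cod\<close> as functions, all premises are determined by matching the arrows; the next
  lemmas and the two characterizations of semifunctors and transformations follow the same
  plan.\<close>

lemma (in category) comp_simps:
  assumes "f \<in> Arr C" "g \<in> Arr C" "Dom C g = Cod C f"
  shows "g \<cdot> f \<in> Arr C" "Dom C (g \<cdot> f) = Dom C f" "Cod C (g \<cdot> f) = Cod C g"
  using Comp_hom[of f "Dom C f" "Cod C f" g "Cod C g"] assms by (auto simp: hom_iff)

lemma (in category) assoc:
  assumes "f \<in> Arr C" "g \<in> Arr C" "h \<in> Arr C" "Dom C g = Cod C f" "Dom C h = Cod C g"
  shows "h \<cdot> g \<cdot> f = h \<cdot> (g \<cdot> f)"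
  using Comp_assoc[of f "Dom C f" "Cod C f" g "Cod C g" h "Cod C h"] assms by (auto simp: hom_iff)

lemma (in category) ide_simps:
  "X \<in> Obj C \<Longrightarrow> Ide C X \<in> Arr C"
  "X \<in> Obj C \<Longrightarrow> Dom C (Ide C X) = X"
  "X \<in> Obj C \<Longrightarrow> Cod C (Ide C X) = X"
  "f \<in> Arr C \<Longrightarrow> Dom C f = X \<Longrightarrow> f \<cdot> Ide C X = f"
  "f \<in> Arr C \<Longrightarrow> Cod C f = Y \<Longrightarrow> Ide C Y \<cdot> f = f"
  using Ide_hom Comp_Ide Ide_Comp by (auto simp: hom_iff)

lemmas (in category) cat_simps = Dom_Obj Cod_Obj comp_simps assoc ide_simps

lemma is_semifunctor_iff:
  assumes "category C"
  shows "is_semifunctor C D F \<longleftrightarrow>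
    (\<forall>X \<in> Obj C. OMap F X \<in> Obj D) \<and>
    (\<forall>f \<in> Arr C. AMap F f \<in> Arr D \<and>
      Dom D (AMap F f) = OMap F (Dom C f) \<and> Cod D (AMap F f) = OMap F (Cod C f)) \<and>
    (\<forall>f \<in> Arr C. \<forall>g \<in> Arr C. Dom C g = Cod C f \<longrightarrow>
      AMap F (g \<cdot>\<^bsub>C\<^esub> f) = AMap F g \<cdot>\<^bsub>D\<^esub> AMap F f)"
proof -
  interpret category C by fact
  show ?thesis
    unfolding is_semifunctor_def hom_iff by (fastforce simp: Dom_Obj Cod_Obj hom_iff)
qed

lemma nat_trans_iff:
  assumes "category C"
  shows "nat_trans C D F F' \<alpha> \<longleftrightarrow>
    (\<forall>X \<in> Obj C. \<alpha> X \<in> Arr D \<and> Dom D (\<alpha> X) = OMap F X \<and> Cod D (\<alpha> X) = OMap F' X) \<and>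
    (\<forall>f \<in> Arr C. \<alpha> (Cod C f) \<cdot>\<^bsub>D\<^esub> AMap F f = AMap F' f \<cdot>\<^bsub>D\<^esub> \<alpha> (Dom C f))"
proof -
  interpret category C by fact
  show ?thesis
    unfolding nat_trans_def hom_iff by (fastforce simp: Dom_Obj Cod_Obj hom_iff)
qed

lemma functor_sel [simp]:
  "OMap id_functor X = X" "AMap id_functor f = f"
  "OMap (G \<odot> F) X = OMap G (OMap F X)" "AMap (G \<odot> F) f = AMap G (AMap F f)"
  by (simp_all add: id_functor_def comp_functor_def)

lemma is_semifunctor_comp:
  assumes "category C" "category D" "is_semifunctor C D F" "is_semifunctor D E G"
  shows "is_semifunctor C E (G \<odot> F)"
  using assms by (simp add: is_semifunctor_iff)

lemma is_semifunctor_id: "category C \<Longrightarrow> is_semifunctor C C id_functor"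
  by (simp add: is_semifunctor_iff)

lemma nat_trans_vcomp:
  assumes "category C" "category D" "is_semifunctor C D F" "is_semifunctor C D F'"
    "is_semifunctor C D F''" "nat_trans C D F F' \<alpha>" "nat_trans C D F' F'' \<beta>"
  shows "nat_trans C D F F'' (\<lambda>X. \<beta> X \<cdot>\<^bsub>D\<^esub> \<alpha> X)"
proof -
  interpret C: category C by fact
  interpret D: category D by fact
  note S = assms(3-5)[unfolded is_semifunctor_iff[OF assms(1)]]
    assms(6,7)[unfolded nat_trans_iff[OF assms(1)]]
  have "\<beta> (Cod C f) \<cdot>\<^bsub>D\<^esub> \<alpha> (Cod C f) \<cdot>\<^bsub>D\<^esub> AMap F f =
      AMap F'' f \<cdot>\<^bsub>D\<^esub> (\<beta> (Dom C f) \<cdot>\<^bsub>D\<^esub> \<alpha> (Dom C f))" if f: "f \<in> Arr C" for f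
  proof -
    have "\<beta> (Cod C f) \<cdot>\<^bsub>D\<^esub> \<alpha> (Cod C f) \<cdot>\<^bsub>D\<^esub> AMap F f =
        \<beta> (Cod C f) \<cdot>\<^bsub>D\<^esub> (AMap F' f \<cdot>\<^bsub>D\<^esub> \<alpha> (Dom C f))"
      using S f by (simp add: D.cat_simps C.cat_simps)
    \<comment> \<open>Simplification nests composites to the right. To expose an inner pair for
      naturality, associativity is applied once against that direction, here and in the later
      chains.\<close>
    also have "\<dots> = \<beta> (Cod C f) \<cdot>\<^bsub>D\<^esub> AMap F' f \<cdot>\<^bsub>D\<^esub> \<alpha> (Dom C f)"
      by (rule D.assoc[symmetric]) (use S f in \<open>simp_all add: C.cat_simps\<close>)
    also have "\<dots> = AMap F'' f \<cdot>\<^bsub>D\<^esub> \<beta> (Dom C f) \<cdot>\<^bsub>D\<^esub> \<alpha> (Dom C f)"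
      using S f by simp
    finally show ?thesis
      using S f by (simp add: D.cat_simps C.cat_simps)
  qed
  then show ?thesis
    using S by (simp add: nat_trans_iff[OF assms(1)] D.cat_simps)
qed

section \<open>Duality\<close>

text \<open>Objects and arrows stay the same, so semifunctors and families of components pass to the
  opposite category as unchanged data. This lets statements about counits be read off from those
  about units.\<close>

definition opposite :: "('o, 'a) category \<Rightarrow> ('o, 'a) category" where
  "opposite C = \<lparr>Obj = Obj C, Arr = Arr C, Dom = Cod C, Cod = Dom C, Ide = Ide C,
    Comp = (\<lambda>g f. f \<cdot>\<^bsub>C\<^esub> g)\<rparr>"

lemma opposite_sel [simp]:
  "Obj (opposite C) = Obj C" "Arr (opposite C) = Arr C" "Dom (opposite C) = Cod C"
  "Cod (opposite C) = Dom C" "Ide (opposite C) = Ide C" "g \<cdot>\<^bsub>opposite C\<^esub> f = f \<cdot>\<^bsub>C\<^esub> g"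
  by (simp_all add: opposite_def)

lemma hom_opposite [simp]: "hom (opposite C) X Y = hom C Y X"
  by (auto simp: hom_iff)

lemma category_opposite:
  assumes "category C"
  shows "category (opposite C)"
proof -
  interpret category C by fact
  show ?thesis
    by (rule category.intro) (auto simp: hom_iff cat_simps)
qed

lemma is_semifunctor_opposite:
  "category C \<Longrightarrow> is_semifunctor (opposite C) (opposite D) F = is_semifunctor C D F"
  by (subst (1 2) is_semifunctor_iff) (auto simp: category_opposite)

lemma is_functor_opposite:
  "category C \<Longrightarrow> is_functor (opposite C) (opposite D) F = is_functor C D F"
  by (simp add: is_functor_def is_semifunctor_opposite)

lemma nat_trans_opposite:
  "category C \<Longrightarrow> nat_trans (opposite C) (opposite D) F F' \<alpha> = nat_trans C D F' F \<alpha>"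
  by (subst (1 2) nat_trans_iff) (auto simp: category_opposite)

lemma adjunction_opposite:
  assumes "category C" "category D"
  shows "adjunction (opposite D) (opposite C) G F \<epsilon> \<eta> = adjunction C D F G \<eta> \<epsilon>"
  using assms by (auto simp: adjunction_def is_functor_opposite nat_trans_opposite)

lemma fully_faithful_opposite:
  "fully_faithful (opposite C) (opposite D) F = fully_faithful C D F"
  by (auto simp: fully_faithful_def)

section \<open>Invertible units and counits\<close>

text \<open>Mutually inverse as transformations of semifunctors: the composites are \<open>F Id\<close> and \<open>F' Id\<close>,
  whose components need not be identities.\<close>

definition inverse_transformations ::
    "('o, 'a) category \<Rightarrow> ('p, 'b) category \<Rightarrow> ('o, 'a, 'p, 'b) semifunctor_data \<Rightarrow>
      ('o, 'a, 'p, 'b) semifunctor_data \<Rightarrow> ('o \<Rightarrow> 'b) \<Rightarrow> ('o \<Rightarrow> 'b) \<Rightarrow> bool" where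
  "inverse_transformations C D F F' \<alpha> \<beta> \<longleftrightarrow>
    nat_trans C D F F' \<alpha> \<and> nat_trans C D F' F \<beta> \<and>
    (\<forall>X \<in> Obj C. \<beta> X \<cdot>\<^bsub>D\<^esub> \<alpha> X = AMap F (Ide C X)) \<and>
    (\<forall>X \<in> Obj C. \<alpha> X \<cdot>\<^bsub>D\<^esub> \<beta> X = AMap F' (Ide C X))"

lemma inverse_transformations_sym:
  "inverse_transformations C D F F' \<alpha> \<beta> \<Longrightarrow> inverse_transformations C D F' F \<beta> \<alpha>"
  by (auto simp: inverse_transformations_def)

lemma inverse_transformations_opposite:
  "category C \<Longrightarrow>
    inverse_transformations (opposite C) (opposite D) F F' \<alpha> \<beta> =
    inverse_transformations C D F F' \<beta> \<alpha>"
  by (auto simp: inverse_transformations_def nat_trans_opposite)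

text \<open>Fullness supplies \<nu> X : GFX -> X with F (\<nu> X) = \<epsilon> (FX). Since F is
  faithful, equations between arrows of C may be tested after applying F, where they become a
  triangle identity or naturality of \<epsilon>.\<close>

lemma inverse_unit_if_fully_faithful:
  assumes C: "category C" and D: "category D"
    and adj: "adjunction C D F G \<eta> \<epsilon>" and ff: "fully_faithful C D F"
  obtains \<nu> where "inverse_transformations C C id_functor (G \<odot> F) \<eta> \<nu>"
proof -
  interpret C: category C by fact
  interpret D: category D by fact
  note A = adj[unfolded adjunction_def is_functor_def is_semifunctor_iff[OF C]
      is_semifunctor_iff[OF D] nat_trans_iff[OF C] nat_trans_iff[OF D] functor_sel]
  note S = C.cat_simps D.cat_simps
  have faithful: "f = g" if "f \<in> Arr C" "g \<in> Arr C" "Dom C f = Dom C g" "Cod C f = Cod C g"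
    "AMap F f = AMap F g" for f g
  proof -
    have "f \<in> hom C (Dom C f) (Cod C f)" "g \<in> hom C (Dom C f) (Cod C f)"
      using that by (simp_all add: hom_iff)
    then show ?thesis
      using ff that(5) C.Dom_Obj[OF that(1)] C.Cod_Obj[OF that(1)]
      unfolding fully_faithful_def bij_betw_def inj_on_def by blast
  qed
  have "\<exists>f \<in> hom C (OMap G (OMap F X)) X. AMap F f = \<epsilon> (OMap F X)" if "X \<in> Obj C" for X
  proof -
    have "\<epsilon> (OMap F X) \<in> hom D (OMap F (OMap G (OMap F X))) (OMap F X)"
      using A that by (simp add: hom_iff)
    moreover have "AMap F ` hom C (OMap G (OMap F X)) X =
        hom D (OMap F (OMap G (OMap F X))) (OMap F X)"
      using ff A that by (simp add: fully_faithful_def bij_betw_def)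
    ultimately show ?thesis by (metis imageE)
  qed
  then have "\<forall>X \<in> Obj C. \<exists>f. f \<in> hom C (OMap G (OMap F X)) X \<and> AMap F f = \<epsilon> (OMap F X)"
    by blast
  from bchoice[OF this] obtain \<nu> where \<nu>: "\<forall>X \<in> Obj C. \<nu> X \<in> Arr C \<and>
      Dom C (\<nu> X) = OMap G (OMap F X) \<and> Cod C (\<nu> X) = X \<and> AMap F (\<nu> X) = \<epsilon> (OMap F X)"
    by (auto simp: hom_iff)
  have "\<nu> X \<cdot>\<^bsub>C\<^esub> \<eta> X = Ide C X" if "X \<in> Obj C" for X
    using A \<nu> that by (intro faithful) (simp_all add: S)
  moreover have "\<eta> X \<cdot>\<^bsub>C\<^esub> \<nu> X = Ide C (OMap G (OMap F X))" if X: "X \<in> Obj C" for X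
  proof -
    \<comment> \<open>Naturality of \<eta> at \<nu> X. As F (\<nu> X) is a counit component, the
      triangle identity for G finishes the computation.\<close>
    have "\<eta> X \<cdot>\<^bsub>C\<^esub> \<nu> X = AMap G (AMap F (\<nu> X)) \<cdot>\<^bsub>C\<^esub> \<eta> (OMap G (OMap F X))"
      using A \<nu> X by metis
    then show ?thesis
      using A \<nu> X by simp
  qed
  moreover have "\<nu> (Cod C f) \<cdot>\<^bsub>C\<^esub> AMap G (AMap F f) = f \<cdot>\<^bsub>C\<^esub> \<nu> (Dom C f)" if f: "f \<in> Arr C" for f
  proof (intro faithful)
    have "\<epsilon> (OMap F (Cod C f)) \<cdot>\<^bsub>D\<^esub> AMap F (AMap G (AMap F f)) = AMap F f \<cdot>\<^bsub>D\<^esub> \<epsilon> (OMap F (Dom C f))"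
      using A f by metis
    then show "AMap F (\<nu> (Cod C f) \<cdot>\<^bsub>C\<^esub> AMap G (AMap F f)) = AMap F (f \<cdot>\<^bsub>C\<^esub> \<nu> (Dom C f))"
      using A \<nu> f by (simp add: S)
  qed (use A \<nu> f in \<open>simp_all add: S\<close>)
  ultimately have "inverse_transformations C C id_functor (G \<odot> F) \<eta> \<nu>"
    using A \<nu> by (simp add: inverse_transformations_def nat_trans_iff[OF C] S)
  then show thesis by (rule that)
qed

text \<open>The inverse of F on hom-sets sends h : FX -> FY to \<nu> Y \<cdot> G h \<cdot> \<eta> X,
  the adjoint transpose of h followed by the inverse unit.\<close>

lemma fully_faithful_if_inverse_unit:
  assumes C: "category C" and D: "category D"
    and adj: "adjunction C D F G \<eta> \<epsilon>"
    and inv: "inverse_transformations C C id_functor (G \<odot> F) \<eta> \<nu>"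
  shows "fully_faithful C D F"
proof -
  interpret C: category C by fact
  interpret D: category D by fact
  note A = adj[unfolded adjunction_def is_functor_def is_semifunctor_iff[OF C]
      is_semifunctor_iff[OF D] nat_trans_iff[OF C] nat_trans_iff[OF D] functor_sel]
  note I = inv[unfolded inverse_transformations_def nat_trans_iff[OF C] functor_sel]
  note S = C.cat_simps D.cat_simps
  show ?thesis
    unfolding fully_faithful_def bij_betw_def inj_on_def
  proof (intro ballI conjI impI)
    fix X Y f g
    assume f: "f \<in> hom C X Y" and g: "g \<in> hom C X Y" and eq: "AMap F f = AMap F g"
    \<comment> \<open>Naturality of \<nu> moves h to the front, where \<nu> X \<cdot> \<eta> X
      cancels. So h is determined by F h.\<close>
    have *: "h = \<nu> Y \<cdot>\<^bsub>C\<^esub> AMap G (AMap F h) \<cdot>\<^bsub>C\<^esub> \<eta> X" if h: "h \<in> hom C X Y" for h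
    proof -
      have "\<nu> Y \<cdot>\<^bsub>C\<^esub> AMap G (AMap F h) \<cdot>\<^bsub>C\<^esub> \<eta> X = h \<cdot>\<^bsub>C\<^esub> \<nu> X \<cdot>\<^bsub>C\<^esub> \<eta> X"
        using I h by (auto simp: hom_iff)
      then show ?thesis
        using I h by (auto simp: hom_iff S)
    qed
    show "f = g"
      by (rule trans[OF *[OF f] trans[OF _ *[OF g, symmetric]]]) (simp only: eq)
  next
    fix X Y assume X: "X \<in> Obj C" and Y: "Y \<in> Obj C"
    show "AMap F ` hom C X Y = hom D (OMap F X) (OMap F Y)"
    proof
      show "AMap F ` hom C X Y \<subseteq> hom D (OMap F X) (OMap F Y)"
        using A by (auto simp: hom_iff)
      show "hom D (OMap F X) (OMap F Y) \<subseteq> AMap F ` hom C X Y"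
      proof
        fix h assume h: "h \<in> hom D (OMap F X) (OMap F Y)"
        define f where "f = \<nu> Y \<cdot>\<^bsub>C\<^esub> (AMap G h \<cdot>\<^bsub>C\<^esub> \<eta> X)"
        have f: "f \<in> hom C X Y"
          using A I h X Y by (simp add: f_def hom_iff S)
        have "\<eta> Y \<cdot>\<^bsub>C\<^esub> f = (\<eta> Y \<cdot>\<^bsub>C\<^esub> \<nu> Y) \<cdot>\<^bsub>C\<^esub> (AMap G h \<cdot>\<^bsub>C\<^esub> \<eta> X)"
          unfolding f_def
          by (rule C.assoc[symmetric]) (use A I h X Y in \<open>simp_all add: hom_iff S\<close>)
        also have "\<dots> = AMap G h \<cdot>\<^bsub>C\<^esub> \<eta> X"
          using A I h X Y by (simp add: hom_iff S)
        finally have *: "\<eta> Y \<cdot>\<^bsub>C\<^esub> f = AMap G h \<cdot>\<^bsub>C\<^esub> \<eta> X" .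
        \<comment> \<open>By \<open>*\<close>, F f and h have the same transpose X -> GFY; the chain
          undoes transposition by applying F and composing with \<epsilon>.\<close>
        have "AMap F f = \<epsilon> (OMap F Y) \<cdot>\<^bsub>D\<^esub> AMap F (\<eta> Y) \<cdot>\<^bsub>D\<^esub> AMap F f"
          using A f X Y by (simp add: hom_iff S)
        also have "\<dots> = \<epsilon> (OMap F Y) \<cdot>\<^bsub>D\<^esub> AMap F (\<eta> Y \<cdot>\<^bsub>C\<^esub> f)"
          by (subst D.assoc) (use A f X Y in \<open>simp_all add: hom_iff\<close>)
        also have "\<dots> = \<epsilon> (OMap F Y) \<cdot>\<^bsub>D\<^esub> AMap F (AMap G h) \<cdot>\<^bsub>D\<^esub> AMap F (\<eta> X)"
          unfolding * by (subst D.assoc) (use A h X Y in \<open>simp_all add: hom_iff\<close>)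
        also have "\<dots> = h \<cdot>\<^bsub>D\<^esub> \<epsilon> (OMap F X) \<cdot>\<^bsub>D\<^esub> AMap F (\<eta> X)"
          using A h X Y by (auto simp: hom_iff)
        also have "\<dots> = h"
          by (subst D.assoc) (use A h X Y in \<open>simp_all add: hom_iff S\<close>)
        finally show "h \<in> AMap F ` hom C X Y"
          using f by blast
      qed
    qed
  qed
qed

lemma inverse_counit_if_fully_faithful:
  assumes C: "category C" and D: "category D"
    and adj: "adjunction C D F G \<eta> \<epsilon>" and ff: "fully_faithful D C G"
  obtains \<gamma> where "inverse_transformations D D id_functor (F \<odot> G) \<gamma> \<epsilon>"
proof -
  have "adjunction (opposite D) (opposite C) G F \<epsilon> \<eta>"
    using adj by (simp add: adjunction_opposite C D)
  moreover have "fully_faithful (opposite D) (opposite C) G"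
    using ff by (simp add: fully_faithful_opposite)
  ultimately obtain \<gamma> where
    "inverse_transformations (opposite D) (opposite D) id_functor (F \<odot> G) \<epsilon> \<gamma>"
    by (rule inverse_unit_if_fully_faithful[OF category_opposite[OF D] category_opposite[OF C]])
  then show thesis
    using that by (simp add: inverse_transformations_opposite D)
qed

lemma fully_faithful_if_inverse_counit:
  assumes C: "category C" and D: "category D"
    and adj: "adjunction C D F G \<eta> \<epsilon>"
    and inv: "inverse_transformations D D id_functor (F \<odot> G) \<gamma> \<epsilon>"
  shows "fully_faithful D C G"
proof -
  have "adjunction (opposite D) (opposite C) G F \<epsilon> \<eta>"
    using adj by (simp add: adjunction_opposite C D)
  moreover have "inverse_transformations (opposite D) (opposite D) id_functor (F \<odot> G) \<epsilon> \<gamma>"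
    using inv by (simp add: inverse_transformations_opposite D)
  ultimately have "fully_faithful (opposite D) (opposite C) G"
    by (rule fully_faithful_if_inverse_unit[OF category_opposite[OF D] category_opposite[OF C]])
  then show ?thesis
    by (simp add: fully_faithful_opposite)
qed

section \<open>Extending transformations to the idempotent completions\<close>

definition underlying :: "('o \<times> 'a) \<times> 'a \<times> ('o \<times> 'a) \<Rightarrow> 'a" where
  "underlying f = fst (snd f)"

lemma completion_sel:
  "Obj (completion C) = completion_objs C"
  "Dom (completion C) f = fst f"
  "Cod (completion C) f = snd (snd f)"
  "Ide (completion C) A = (A, snd A, A)"
  "g \<cdot>\<^bsub>completion C\<^esub> f = (fst f, underlying g \<cdot>\<^bsub>C\<^esub> underlying f, snd (snd g))"
  by (simp_all add: completion_def underlying_def split_beta)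

text \<open>Because e and e' are idempotent, f = e' \<cdot> f \<cdot> e is equivalent to f absorbing
  each of them separately. The two absorption laws can be used as rewrite rules.\<close>

lemma arr_completion_iff:
  assumes "category C"
  shows "f \<in> Arr (completion C) \<longleftrightarrow>
    fst f \<in> completion_objs C \<and> snd (snd f) \<in> completion_objs C \<and>
    underlying f \<in> hom C (fst (fst f)) (fst (snd (snd f))) \<and>
    underlying f \<cdot>\<^bsub>C\<^esub> snd (fst f) = underlying f \<and> snd (snd (snd f)) \<cdot>\<^bsub>C\<^esub> underlying f = underlying f"
proof -
  interpret category C by fact
  obtain A f0 B where f: "f = (A, f0, B)" by (cases f)
  have "f0 = snd B \<cdot>\<^bsub>C\<^esub> f0 \<cdot>\<^bsub>C\<^esub> snd A \<longleftrightarrow> f0 \<cdot>\<^bsub>C\<^esub> snd A = f0 \<and> snd B \<cdot>\<^bsub>C\<^esub> f0 = f0"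
    if A: "A \<in> completion_objs C" and B: "B \<in> completion_objs C" and f0: "f0 \<in> hom C (fst A) (fst B)"
  proof
    note AB = A[unfolded completion_objs_iff hom_iff] B[unfolded completion_objs_iff hom_iff]
      f0[unfolded hom_iff]
    assume eq: "f0 = snd B \<cdot>\<^bsub>C\<^esub> f0 \<cdot>\<^bsub>C\<^esub> snd A"
    have "f0 \<cdot>\<^bsub>C\<^esub> snd A = snd B \<cdot>\<^bsub>C\<^esub> f0 \<cdot>\<^bsub>C\<^esub> snd A \<cdot>\<^bsub>C\<^esub> snd A" using eq by simp
    also have "\<dots> = snd B \<cdot>\<^bsub>C\<^esub> f0 \<cdot>\<^bsub>C\<^esub> (snd A \<cdot>\<^bsub>C\<^esub> snd A)" using AB by (intro assoc) (simp_all add: cat_simps)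
    finally have 1: "f0 \<cdot>\<^bsub>C\<^esub> snd A = f0" using AB eq by simp
    with eq AB have "snd B \<cdot>\<^bsub>C\<^esub> f0 = f0" by (simp add: assoc)
    with 1 show "f0 \<cdot>\<^bsub>C\<^esub> snd A = f0 \<and> snd B \<cdot>\<^bsub>C\<^esub> f0 = f0" by simp
  qed simp
  then show ?thesis
    by (auto simp: f completion_def underlying_def)
qed

lemma functor_completion_sel:
  "OMap (functor_completion F) A = (OMap F (fst A), AMap F (snd A))"
  "AMap (functor_completion F) f =
    (OMap (functor_completion F) (fst f), AMap F (underlying f), OMap (functor_completion F) (snd (snd f)))"
  by (simp_all add: functor_completion_def completion_obj_def underlying_def split_beta)

lemma functor_completion_id [simp]: "functor_completion id_functor = id_functor"
  by (simp add: functor_completion_def completion_obj_def id_functor_def split_beta id_def)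

lemma functor_completion_comp:
  "functor_completion (G \<odot> F) = functor_completion G \<odot> functor_completion F"
  by (simp add: functor_completion_def completion_obj_def comp_functor_def split_beta fun_eq_iff)

definition nat_completion ::
    "('p, 'b) category \<Rightarrow> ('o, 'a, 'p, 'b) semifunctor_data \<Rightarrow> ('o, 'a, 'p, 'b) semifunctor_data \<Rightarrow>
      ('o \<Rightarrow> 'b) \<Rightarrow> 'o \<times> 'a \<Rightarrow> ('p \<times> 'b) \<times> 'b \<times> ('p \<times> 'b)" where
  "nat_completion D F F' \<alpha> A =
    (OMap (functor_completion F) A, \<alpha> (fst A) \<cdot>\<^bsub>D\<^esub> AMap F (snd A), OMap (functor_completion F') A)"

text \<open>Naturality at e gives \<alpha> X \<cdot> F e = F' e \<cdot> \<alpha> X, so multiplying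
  by the idempotent on one side already makes the component absorb the idempotents at both
  ends.\<close>

lemma nat_trans_completion:
  assumes C: "category C" and D: "category D"
    and F: "is_semifunctor C D F" and F': "is_semifunctor C D F'" and \<alpha>: "nat_trans C D F F' \<alpha>"
  shows "nat_trans (completion C) (completion D) (functor_completion F) (functor_completion F')
    (nat_completion D F F' \<alpha>)"
proof -
  interpret C: category C by fact
  interpret D: category D by fact
  note A = F[unfolded is_semifunctor_iff[OF C]] F'[unfolded is_semifunctor_iff[OF C]]
    \<alpha>[unfolded nat_trans_iff[OF C]]
  have functor_obj: "OMap (functor_completion H) B \<in> completion_objs D"
    if "is_semifunctor C D H" "B \<in> completion_objs C" for H B
    using is_functor_functor_completion[OF C that(1)] that(2)
    by (simp add: is_functor_def is_semifunctor_def completion_sel(1))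
  have comp: "AMap H g \<cdot>\<^bsub>D\<^esub> AMap H f = AMap H (g \<cdot>\<^bsub>C\<^esub> f)"
    if "is_semifunctor C D H" "f \<in> Arr C" "g \<in> Arr C" "Dom C g = Cod C f" for H f g
    using that by (simp add: is_semifunctor_iff[OF C])
  show ?thesis
    unfolding nat_trans_iff[OF category_completion[OF C]] completion_sel(1)
  proof (intro conjI ballI)
    fix B assume B: "B \<in> completion_objs C"
    obtain X e where XB: "B = (X, e)" by (cases B)
    have e: "X \<in> Obj C" "e \<in> Arr C" "Dom C e = X" "Cod C e = X" "e \<cdot>\<^bsub>C\<^esub> e = e"
      using B by (simp_all add: XB completion_objs_iff hom_iff)
    have 1: "\<alpha> X \<cdot>\<^bsub>D\<^esub> AMap F e = AMap F' e \<cdot>\<^bsub>D\<^esub> \<alpha> X"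
      using A e by metis
    have 2: "AMap F' e \<cdot>\<^bsub>D\<^esub> (\<alpha> X \<cdot>\<^bsub>D\<^esub> AMap F e) = \<alpha> X \<cdot>\<^bsub>D\<^esub> AMap F e"
    proof -
      have "AMap F' e \<cdot>\<^bsub>D\<^esub> (\<alpha> X \<cdot>\<^bsub>D\<^esub> AMap F e) = AMap F' e \<cdot>\<^bsub>D\<^esub> AMap F' e \<cdot>\<^bsub>D\<^esub> \<alpha> X"
        unfolding 1 by (rule D.assoc[symmetric]) (use A e in simp_all)
      then show ?thesis by (simp add: comp F' e 1)
    qed
    have 3: "\<alpha> X \<cdot>\<^bsub>D\<^esub> AMap F e \<cdot>\<^bsub>D\<^esub> AMap F e = \<alpha> X \<cdot>\<^bsub>D\<^esub> AMap F e"
      using A e by (simp add: D.assoc comp F)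
    have "nat_completion D F F' \<alpha> B \<in> Arr (completion D)"
      unfolding arr_completion_iff[OF D]
      using functor_obj[OF F B] functor_obj[OF F' B] A e B 2 3
      by (simp add: nat_completion_def underlying_def XB functor_completion_sel hom_iff D.cat_simps)
    then show "nat_completion D F F' \<alpha> B \<in> Arr (completion D)"
      "Dom (completion D) (nat_completion D F F' \<alpha> B) = OMap (functor_completion F) B"
      "Cod (completion D) (nat_completion D F F' \<alpha> B) = OMap (functor_completion F') B"
      by (simp_all add: nat_completion_def completion_sel)
  next
    fix g assume g: "g \<in> Arr (completion C)"
    obtain X a f Y b where XY: "g = ((X, a), f, (Y, b))" by (cases g) auto
    have f: "X \<in> Obj C" "Y \<in> Obj C" "a \<in> Arr C" "Dom C a = X" "Cod C a = X"
      "b \<in> Arr C" "Dom C b = Y" "Cod C b = Y" "f \<in> Arr C" "Dom C f = X" "Cod C f = Y"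
      "f \<cdot>\<^bsub>C\<^esub> a = f" "b \<cdot>\<^bsub>C\<^esub> f = f"
      using g by (simp_all add: XY arr_completion_iff[OF C] underlying_def completion_objs_iff hom_iff)
    \<comment> \<open>The idempotents disappear through f \<cdot> a = f = b \<cdot> f; what remains
      is naturality of \<alpha> at f.\<close>
    have "AMap F' f \<cdot>\<^bsub>D\<^esub> (\<alpha> X \<cdot>\<^bsub>D\<^esub> AMap F a) = AMap F' f \<cdot>\<^bsub>D\<^esub> \<alpha> X \<cdot>\<^bsub>D\<^esub> AMap F a"
      by (rule D.assoc[symmetric]) (use A f in simp_all)
    also have "AMap F' f \<cdot>\<^bsub>D\<^esub> \<alpha> X = \<alpha> Y \<cdot>\<^bsub>D\<^esub> AMap F f"
      using A f by metis
    also have "\<alpha> Y \<cdot>\<^bsub>D\<^esub> AMap F f \<cdot>\<^bsub>D\<^esub> AMap F a = \<alpha> Y \<cdot>\<^bsub>D\<^esub> AMap F b \<cdot>\<^bsub>D\<^esub> AMap F f"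
      using A f by (simp add: D.assoc comp F)
    finally show "nat_completion D F F' \<alpha> (Cod (completion C) g) \<cdot>\<^bsub>completion D\<^esub>
        AMap (functor_completion F) g =
      AMap (functor_completion F') g \<cdot>\<^bsub>completion D\<^esub>
        nat_completion D F F' \<alpha> (Dom (completion C) g)"
      by (simp add: XY completion_sel nat_completion_def functor_completion_sel underlying_def)
  qed
qed

text \<open>Moving the idempotents past \<alpha> leaves \<beta> X \<cdot> \<alpha> X \<cdot> F e = F
  Id \<cdot> F e = F e, the identity of (FX, Fe). Thus inverses up to F Id become honest
  inverses.\<close>

lemma nat_completion_comp:
  assumes C: "category C" and D: "category D"
    and F: "is_semifunctor C D F" and F': "is_semifunctor C D F'"
    and \<alpha>: "nat_trans C D F F' \<alpha>" and \<beta>: "nat_trans C D F' F \<beta>"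
    and inv: "\<forall>X \<in> Obj C. \<beta> X \<cdot>\<^bsub>D\<^esub> \<alpha> X = AMap F (Ide C X)"
    and B: "B \<in> completion_objs C"
  shows "nat_completion D F' F \<beta> B \<cdot>\<^bsub>completion D\<^esub> nat_completion D F F' \<alpha> B =
    AMap (functor_completion F) (Ide (completion C) B)"
proof -
  interpret C: category C by fact
  interpret D: category D by fact
  note A = F[unfolded is_semifunctor_iff[OF C]] F'[unfolded is_semifunctor_iff[OF C]]
    \<alpha>[unfolded nat_trans_iff[OF C]] \<beta>[unfolded nat_trans_iff[OF C]]
  obtain X e where XB: "B = (X, e)" by (cases B)
  have e: "X \<in> Obj C" "e \<in> Arr C" "Dom C e = X" "Cod C e = X" "e \<cdot>\<^bsub>C\<^esub> e = e"
    using B by (simp_all add: XB completion_objs_iff hom_iff)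
  have comp: "AMap F g \<cdot>\<^bsub>D\<^esub> AMap F f = AMap F (g \<cdot>\<^bsub>C\<^esub> f)"
    if "f \<in> Arr C" "g \<in> Arr C" "Dom C g = Cod C f" for f g
    using that A by simp
  have 1: "AMap F' e \<cdot>\<^bsub>D\<^esub> \<alpha> X = \<alpha> X \<cdot>\<^bsub>D\<^esub> AMap F e"
    using A e by metis
  have "\<beta> X \<cdot>\<^bsub>D\<^esub> AMap F' e \<cdot>\<^bsub>D\<^esub> (\<alpha> X \<cdot>\<^bsub>D\<^esub> AMap F e) =
      \<beta> X \<cdot>\<^bsub>D\<^esub> (AMap F' e \<cdot>\<^bsub>D\<^esub> \<alpha> X \<cdot>\<^bsub>D\<^esub> AMap F e)"
    using A e by (simp add: D.cat_simps)
  also have "\<dots> = \<beta> X \<cdot>\<^bsub>D\<^esub> (\<alpha> X \<cdot>\<^bsub>D\<^esub> AMap F e)"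
    unfolding 1 using A e by (simp add: D.assoc comp)
  also have "\<dots> = \<beta> X \<cdot>\<^bsub>D\<^esub> \<alpha> X \<cdot>\<^bsub>D\<^esub> AMap F e"
    by (rule D.assoc[symmetric]) (use A e in simp_all)
  also have "\<dots> = AMap F e"
    using inv e comp[of e "Ide C X"] by (simp add: C.cat_simps)
  finally show ?thesis
    by (simp add: XB completion_sel nat_completion_def functor_completion_sel underlying_def)
qed

lemma inverse_transformations_completion:
  assumes "category C" "category D" "is_semifunctor C D F" "is_semifunctor C D F'"
    "inverse_transformations C D F F' \<alpha> \<beta>"
  shows "inverse_transformations (completion C) (completion D)
    (functor_completion F) (functor_completion F') (nat_completion D F F' \<alpha>) (nat_completion D F' F \<beta>)"
  using assms unfolding inverse_transformations_def completion_sel(1)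
  by (simp add: nat_trans_completion nat_completion_comp)

text \<open>Naturality pulls e out of the triangle composite and leaves G e \<cdot> G Id \<cdot> G
  e, which is G e, the identity of (GY, Ge); likewise for F. The completion of a mere semifunctor is
  a functor for the same reason: the identity of (X, e) is e.\<close>

lemma adjunction_completion:
  assumes C: "category C" and D: "category D" and adj: "semiadjunction C D F G \<eta> \<epsilon>"
  shows "adjunction (completion C) (completion D) (functor_completion F) (functor_completion G)
    (nat_completion C id_functor (G \<odot> F) \<eta>) (nat_completion D (F \<odot> G) id_functor \<epsilon>)"
proof -
  interpret C: category C by fact
  interpret D: category D by fact
  note S = adj[unfolded semiadjunction_def]
  have F: "is_semifunctor C D F" and G: "is_semifunctor D C G" using S by auto
  note A = S[unfolded is_semifunctor_iff[OF C]
      is_semifunctor_iff[OF D] nat_trans_iff[OF C] nat_trans_iff[OF D] functor_sel]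
  have "AMap (functor_completion G) (nat_completion D (F \<odot> G) id_functor \<epsilon> B) \<cdot>\<^bsub>completion C\<^esub>
      nat_completion C id_functor (G \<odot> F) \<eta> (OMap (functor_completion G) B) =
    Ide (completion C) (OMap (functor_completion G) B)" if B: "B \<in> completion_objs D" for B
  proof -
    obtain Y e where YB: "B = (Y, e)" by (cases B)
    have e: "Y \<in> Obj D" "e \<in> Arr D" "Dom D e = Y" "Cod D e = Y" "e \<cdot>\<^bsub>D\<^esub> e = e"
      using B by (simp_all add: YB completion_objs_iff hom_iff)
    have comp: "AMap G g \<cdot>\<^bsub>C\<^esub> AMap G f = AMap G (g \<cdot>\<^bsub>D\<^esub> f)"
      if "f \<in> Arr D" "g \<in> Arr D" "Dom D g = Cod D f" for f g
      using that A by simp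
    have 1: "\<epsilon> Y \<cdot>\<^bsub>D\<^esub> AMap F (AMap G e) = e \<cdot>\<^bsub>D\<^esub> \<epsilon> Y"
      using A e by metis
    have 2: "\<eta> (OMap G Y) \<cdot>\<^bsub>C\<^esub> AMap G e = AMap G (AMap F (AMap G e)) \<cdot>\<^bsub>C\<^esub> \<eta> (OMap G Y)"
      using A e by metis
    have "AMap G (\<epsilon> Y \<cdot>\<^bsub>D\<^esub> AMap F (AMap G e)) \<cdot>\<^bsub>C\<^esub> (\<eta> (OMap G Y) \<cdot>\<^bsub>C\<^esub> AMap G e) =
        AMap G e \<cdot>\<^bsub>C\<^esub> (AMap G (\<epsilon> Y) \<cdot>\<^bsub>C\<^esub> (\<eta> (OMap G Y) \<cdot>\<^bsub>C\<^esub> AMap G e))"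
      unfolding 1 using A e by (simp add: C.cat_simps)
    also have "AMap G (\<epsilon> Y) \<cdot>\<^bsub>C\<^esub> (\<eta> (OMap G Y) \<cdot>\<^bsub>C\<^esub> AMap G e) = AMap G (\<epsilon> Y) \<cdot>\<^bsub>C\<^esub> \<eta> (OMap G Y) \<cdot>\<^bsub>C\<^esub> AMap G e"
      by (rule C.assoc[symmetric]) (use A e in simp_all)
    also have "AMap G (\<epsilon> Y) \<cdot>\<^bsub>C\<^esub> \<eta> (OMap G Y) = AMap G (Ide D Y)"
      using A e by simp
    also have "AMap G e \<cdot>\<^bsub>C\<^esub> (AMap G (Ide D Y) \<cdot>\<^bsub>C\<^esub> AMap G e) = AMap G e"
      using A e by (simp add: comp D.cat_simps)
    finally show ?thesis
      by (simp add: YB completion_sel nat_completion_def functor_completion_sel underlying_def)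
  qed
  moreover have "nat_completion D (F \<odot> G) id_functor \<epsilon> (OMap (functor_completion F) B) \<cdot>\<^bsub>completion D\<^esub>
      AMap (functor_completion F) (nat_completion C id_functor (G \<odot> F) \<eta> B) =
    Ide (completion D) (OMap (functor_completion F) B)" if B: "B \<in> completion_objs C" for B
  proof -
    obtain X e where XB: "B = (X, e)" by (cases B)
    have e: "X \<in> Obj C" "e \<in> Arr C" "Dom C e = X" "Cod C e = X" "e \<cdot>\<^bsub>C\<^esub> e = e"
      using B by (simp_all add: XB completion_objs_iff hom_iff)
    have comp: "AMap F g \<cdot>\<^bsub>D\<^esub> AMap F f = AMap F (g \<cdot>\<^bsub>C\<^esub> f)"
      if "f \<in> Arr C" "g \<in> Arr C" "Dom C g = Cod C f" for f g
      using that A by simp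
    have 1: "\<epsilon> (OMap F X) \<cdot>\<^bsub>D\<^esub> AMap F (AMap G (AMap F e)) = AMap F e \<cdot>\<^bsub>D\<^esub> \<epsilon> (OMap F X)"
      using A e by metis
    have "\<epsilon> (OMap F X) \<cdot>\<^bsub>D\<^esub> AMap F (AMap G (AMap F e)) \<cdot>\<^bsub>D\<^esub> AMap F (\<eta> X \<cdot>\<^bsub>C\<^esub> e) =
        AMap F e \<cdot>\<^bsub>D\<^esub> (\<epsilon> (OMap F X) \<cdot>\<^bsub>D\<^esub> (AMap F (\<eta> X) \<cdot>\<^bsub>D\<^esub> AMap F e))"
      unfolding 1 using A e by (simp add: D.cat_simps)
    also have "\<epsilon> (OMap F X) \<cdot>\<^bsub>D\<^esub> (AMap F (\<eta> X) \<cdot>\<^bsub>D\<^esub> AMap F e) = \<epsilon> (OMap F X) \<cdot>\<^bsub>D\<^esub> AMap F (\<eta> X) \<cdot>\<^bsub>D\<^esub> AMap F e"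
      by (rule D.assoc[symmetric]) (use A e in simp_all)
    also have "\<epsilon> (OMap F X) \<cdot>\<^bsub>D\<^esub> AMap F (\<eta> X) = AMap F (Ide C X)"
      using A e by simp
    also have "AMap F e \<cdot>\<^bsub>D\<^esub> (AMap F (Ide C X) \<cdot>\<^bsub>D\<^esub> AMap F e) = AMap F e"
      using A e by (simp add: comp C.cat_simps)
    finally show ?thesis
      by (simp add: XB completion_sel nat_completion_def functor_completion_sel underlying_def)
  qed
  moreover have "nat_trans (completion C) (completion C) id_functor
      (functor_completion G \<odot> functor_completion F) (nat_completion C id_functor (G \<odot> F) \<eta>)"
    using nat_trans_completion[OF C C is_semifunctor_id[OF C] is_semifunctor_comp[OF C D F G], of \<eta>] S
    by (simp add: functor_completion_comp)
  moreover have "nat_trans (completion D) (completion D)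
      (functor_completion F \<odot> functor_completion G) id_functor (nat_completion D (F \<odot> G) id_functor \<epsilon>)"
    using nat_trans_completion[OF D D is_semifunctor_comp[OF D C G F] is_semifunctor_id[OF D], of \<epsilon>] S
    by (simp add: functor_completion_comp)
  ultimately show ?thesis
    unfolding adjunction_def completion_sel(1)
    by (simp add: is_functor_functor_completion C D F G)
qed

section \<open>Restricting functors between idempotent completions\<close>

definition embed_obj :: "('o, 'a) category \<Rightarrow> 'o \<Rightarrow> 'o \<times> 'a" where
  "embed_obj C X = (X, Ide C X)"

definition embed :: "('o, 'a) category \<Rightarrow> 'a \<Rightarrow> ('o \<times> 'a) \<times> 'a \<times> ('o \<times> 'a)" where
  "embed C f = (embed_obj C (Dom C f), f, embed_obj C (Cod C f))"

text \<open>In the completion the idempotent e of A = (X, e) splits: read as an arrow A -> (X, Id)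
  it is the section, and read as an arrow (X, Id) -> A, in \<open>retract_proj\<close>, it is the
  retraction.\<close>

definition retract_incl :: "('o, 'a) category \<Rightarrow> 'o \<times> 'a \<Rightarrow> ('o \<times> 'a) \<times> 'a \<times> ('o \<times> 'a)" where
  "retract_incl C A = (A, snd A, embed_obj C (fst A))"

definition retract_proj :: "('o, 'a) category \<Rightarrow> 'o \<times> 'a \<Rightarrow> ('o \<times> 'a) \<times> 'a \<times> ('o \<times> 'a)" where
  "retract_proj C A = (embed_obj C (fst A), snd A, A)"

text \<open>If L is a functor and L (X, Id) = (Y, e), the identity of X is sent to e, so in general
  only a semifunctor results.\<close>

definition restrict ::
    "('o, 'a) category \<Rightarrow>
      ('o \<times> 'a, ('o \<times> 'a) \<times> 'a \<times> ('o \<times> 'a), 'p \<times> 'b, ('p \<times> 'b) \<times> 'b \<times> ('p \<times> 'b)) semifunctor_data \<Rightarrow>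
      ('o, 'a, 'p, 'b) semifunctor_data" where
  "restrict C L = \<lparr>OMap = (\<lambda>X. fst (OMap L (embed_obj C X))), AMap = (\<lambda>f. underlying (AMap L (embed C f)))\<rparr>"

lemma restrict_sel [simp]:
  "OMap (restrict C L) X = fst (OMap L (embed_obj C X))"
  "AMap (restrict C L) f = underlying (AMap L (embed C f))"
  by (simp_all add: restrict_def)

lemma restrict_functor_completion: "restrict C (functor_completion F) = F"
  by (simp add: restrict_def functor_completion_sel embed_def embed_obj_def underlying_def)

lemma restrict_id [simp]: "restrict C id_functor = id_functor"
  by (simp add: restrict_def id_functor_def embed_def embed_obj_def underlying_def)

lemma underlying_comp: "underlying (g \<cdot>\<^bsub>completion C\<^esub> f) = underlying g \<cdot>\<^bsub>C\<^esub> underlying f"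
  by (simp add: completion_sel underlying_def)

lemma underlying_simps:
  "underlying (Ide (completion C) A) = snd A"
  "underlying (retract_incl C A) = snd A"
  "underlying (retract_proj C A) = snd A"
  "underlying (embed C f) = f"
  by (simp_all add: completion_sel underlying_def retract_incl_def retract_proj_def embed_def)

lemma underlying_arr:
  assumes "category C" "f \<in> Arr (completion C)"
  shows "underlying f \<in> Arr C" "Dom C (underlying f) = fst (Dom (completion C) f)"
    "Cod C (underlying f) = fst (Cod (completion C) f)"
  using assms by (simp_all add: arr_completion_iff hom_iff completion_sel)

lemma embed_simps:
  assumes C: "category C"
  shows "X \<in> Obj C \<Longrightarrow> embed_obj C X \<in> Obj (completion C)"
    "fst (embed_obj C X) = X"
    "A \<in> Obj (completion C) \<Longrightarrow> fst A \<in> Obj C"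
    "f \<in> Arr C \<Longrightarrow> embed C f \<in> Arr (completion C)"
    "Dom (completion C) (embed C f) = embed_obj C (Dom C f)"
    "Cod (completion C) (embed C f) = embed_obj C (Cod C f)"
    "X \<in> Obj C \<Longrightarrow> embed C (Ide C X) = Ide (completion C) (embed_obj C X)"
    "f \<in> Arr C \<Longrightarrow> g \<in> Arr C \<Longrightarrow> Dom C g = Cod C f \<Longrightarrow>
      embed C (g \<cdot>\<^bsub>C\<^esub> f) = embed C g \<cdot>\<^bsub>completion C\<^esub> embed C f"
proof -
  interpret category C by fact
  show obj: "X \<in> Obj C \<Longrightarrow> embed_obj C X \<in> Obj (completion C)" for X
    by (simp add: completion_sel embed_obj_def completion_objs_iff hom_iff cat_simps)
  show "f \<in> Arr C \<Longrightarrow> embed C f \<in> Arr (completion C)"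
    using obj[of "Dom C f"] obj[of "Cod C f"]
    by (simp add: arr_completion_iff[OF C] completion_sel embed_def hom_iff cat_simps underlying_def)
      (simp add: embed_obj_def cat_simps)
qed (simp_all add: completion_sel embed_def embed_obj_def completion_objs_iff underlying_def
    category.cat_simps[OF C])

lemma retract_simps:
  assumes C: "category C"
  shows "A \<in> Obj (completion C) \<Longrightarrow> retract_incl C A \<in> Arr (completion C)"
    "A \<in> Obj (completion C) \<Longrightarrow> retract_proj C A \<in> Arr (completion C)"
    "Dom (completion C) (retract_incl C A) = A"
    "Cod (completion C) (retract_incl C A) = embed_obj C (fst A)"
    "Dom (completion C) (retract_proj C A) = embed_obj C (fst A)"
    "Cod (completion C) (retract_proj C A) = A"
    "A \<in> Obj (completion C) \<Longrightarrow>
      retract_proj C A \<cdot>\<^bsub>completion C\<^esub> retract_incl C A = Ide (completion C) A"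
    "retract_incl C (embed_obj C X) = Ide (completion C) (embed_obj C X)"
    "retract_proj C (embed_obj C X) = Ide (completion C) (embed_obj C X)"
proof -
  interpret category C by fact
  assume A: "A \<in> Obj (completion C)"
  then have "embed_obj C (fst A) \<in> Obj (completion C)"
    by (simp add: embed_simps[OF C])
  with A show "retract_incl C A \<in> Arr (completion C)" "retract_proj C A \<in> Arr (completion C)"
    by (simp_all add: arr_completion_iff[OF C] completion_sel retract_incl_def retract_proj_def
      hom_iff underlying_def) (auto simp add: embed_obj_def cat_simps completion_objs_iff hom_iff)
qed (simp_all add: completion_sel retract_incl_def retract_proj_def embed_obj_def
    completion_objs_iff underlying_def)

text \<open>f absorbs the idempotents at its ends, so the retractions leave its underlying arrow
  unchanged and alter only the end objects. The lemma identifies the arrow to which the outer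
  functor is applied in a composite of two restrictions.\<close>

lemma embed_underlying:
  assumes C: "category C" and f: "f \<in> Arr (completion C)"
  shows "embed C (underlying f) = retract_incl C (Cod (completion C) f) \<cdot>\<^bsub>completion C\<^esub>
    (f \<cdot>\<^bsub>completion C\<^esub> retract_proj C (Dom (completion C) f))"
  using f underlying_arr[OF C f]
  by (simp add: embed_def retract_incl_def retract_proj_def arr_completion_iff[OF C])
    (simp add: completion_sel underlying_def)

lemma is_semifunctor_restrict:
  assumes C: "category C" and D: "category D"
    and L: "is_semifunctor (completion C) (completion D) L"
  shows "is_semifunctor C D (restrict C L)"
  using L unfolding is_semifunctor_iff[OF C] is_semifunctor_iff[OF category_completion[OF C]]
  by (simp add: embed_simps[OF C] embed_simps[OF D] underlying_arr[OF D] underlying_comp)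

lemma nat_trans_restrict:
  assumes C: "category C" and D: "category D"
    and \<alpha>: "nat_trans (completion C) (completion D) L L' \<alpha>"
  shows "nat_trans C D (restrict C L) (restrict C L') (\<lambda>X. underlying (\<alpha> (embed_obj C X)))"
  using \<alpha> unfolding nat_trans_iff[OF C] nat_trans_iff[OF category_completion[OF C]]
proof (intro conjI ballI; elim conjE)
  fix f assume f: "f \<in> Arr C"
  assume "\<forall>f \<in> Arr (completion C).
    \<alpha> (Cod (completion C) f) \<cdot>\<^bsub>completion D\<^esub> AMap L f =
    AMap L' f \<cdot>\<^bsub>completion D\<^esub> \<alpha> (Dom (completion C) f)"
  from bspec[OF this, of "embed C f"] f
  show "underlying (\<alpha> (embed_obj C (Cod C f))) \<cdot>\<^bsub>D\<^esub> AMap (restrict C L) f =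
    AMap (restrict C L') f \<cdot>\<^bsub>D\<^esub> underlying (\<alpha> (embed_obj C (Dom C f)))"
    by (simp add: embed_simps[OF C] underlying_comp[symmetric])
qed (simp_all add: embed_simps[OF C] underlying_arr[OF D])

lemma inverse_transformations_restrict:
  assumes C: "category C" and D: "category D"
    and inv: "inverse_transformations (completion C) (completion D) L L' \<alpha> \<beta>"
  shows "inverse_transformations C D (restrict C L) (restrict C L')
    (\<lambda>X. underlying (\<alpha> (embed_obj C X))) (\<lambda>X. underlying (\<beta> (embed_obj C X)))"
  using inv
  by (simp add: inverse_transformations_def nat_trans_restrict C D underlying_comp[symmetric]
      embed_simps[OF C])

text \<open>The inner pair \<beta>' \<cdot> \<alpha>' yields F' Id, which need not be an identity.
  Naturality of \<alpha> turns it into F Id on the right, and this is absorbed because F Id is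
  idempotent.\<close>

lemma inverse_transformations_vcomp:
  assumes C: "category C" and D: "category D"
    and F: "is_semifunctor C D F" "is_semifunctor C D F'" "is_semifunctor C D F''"
    and inv: "inverse_transformations C D F F' \<alpha> \<beta>" "inverse_transformations C D F' F'' \<alpha>' \<beta>'"
  shows "inverse_transformations C D F F'' (\<lambda>X. \<alpha>' X \<cdot>\<^bsub>D\<^esub> \<alpha> X) (\<lambda>X. \<beta> X \<cdot>\<^bsub>D\<^esub> \<beta>' X)"
proof -
  interpret C: category C by fact
  interpret D: category D by fact
  \<comment> \<open>Stated for arbitrary semifunctors, so that the other composite follows by
    running through the three of them in reverse order.\<close>
  have cancel: "\<beta> X \<cdot>\<^bsub>D\<^esub> \<beta>' X \<cdot>\<^bsub>D\<^esub> (\<alpha>' X \<cdot>\<^bsub>D\<^esub> \<alpha> X) = AMap F (Ide C X)"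
    if F: "is_semifunctor C D F" "is_semifunctor C D F'" "is_semifunctor C D F''"
      and inv: "inverse_transformations C D F F' \<alpha> \<beta>" "inverse_transformations C D F' F'' \<alpha>' \<beta>'"
      and X: "X \<in> Obj C"
    for F F' F'' \<alpha> \<beta> \<alpha>' \<beta>' X
  proof -
    note A = F[unfolded is_semifunctor_iff[OF C]]
      inv[unfolded inverse_transformations_def nat_trans_iff[OF C]]
    have "\<beta> X \<cdot>\<^bsub>D\<^esub> \<beta>' X \<cdot>\<^bsub>D\<^esub> (\<alpha>' X \<cdot>\<^bsub>D\<^esub> \<alpha> X) = \<beta> X \<cdot>\<^bsub>D\<^esub> (\<beta>' X \<cdot>\<^bsub>D\<^esub> (\<alpha>' X \<cdot>\<^bsub>D\<^esub> \<alpha> X))"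
      by (rule D.assoc) (use A X in \<open>simp_all add: D.comp_simps\<close>)
    also have "\<beta>' X \<cdot>\<^bsub>D\<^esub> (\<alpha>' X \<cdot>\<^bsub>D\<^esub> \<alpha> X) = \<beta>' X \<cdot>\<^bsub>D\<^esub> \<alpha>' X \<cdot>\<^bsub>D\<^esub> \<alpha> X"
      by (rule D.assoc[symmetric]) (use A X in simp_all)
    also have "\<beta>' X \<cdot>\<^bsub>D\<^esub> \<alpha>' X = AMap F' (Ide C X)"
      using A X by simp
    also have "AMap F' (Ide C X) \<cdot>\<^bsub>D\<^esub> \<alpha> X = \<alpha> X \<cdot>\<^bsub>D\<^esub> AMap F (Ide C X)"
      using A X C.ide_simps by metis
    also have "\<beta> X \<cdot>\<^bsub>D\<^esub> (\<alpha> X \<cdot>\<^bsub>D\<^esub> AMap F (Ide C X)) = \<beta> X \<cdot>\<^bsub>D\<^esub> \<alpha> X \<cdot>\<^bsub>D\<^esub> AMap F (Ide C X)"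
      by (rule D.assoc[symmetric]) (use A X in \<open>simp_all add: C.cat_simps\<close>)
    also have "\<beta> X \<cdot>\<^bsub>D\<^esub> \<alpha> X = AMap F (Ide C X)"
      using A X by simp
    also have "AMap F (Ide C X) \<cdot>\<^bsub>D\<^esub> AMap F (Ide C X) = AMap F (Ide C X \<cdot>\<^bsub>C\<^esub> Ide C X)"
      using A(1) X by (simp add: C.ide_simps(1-3))
    finally show ?thesis
      using X by (simp add: C.ide_simps)
  qed
  note sym = inverse_transformations_sym[OF inv(1)] inverse_transformations_sym[OF inv(2)]
  show ?thesis
    unfolding inverse_transformations_def
    using cancel[OF F inv] cancel[OF F(3,2,1) sym(2,1)] inv
      nat_trans_vcomp[OF C D F, of \<alpha> \<alpha>'] nat_trans_vcomp[OF C D F(3,2,1), of \<beta>' \<beta>]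
    by (simp add: inverse_transformations_def)
qed

text \<open>Restriction preserves composition only up to \<open>inverse_transformations\<close>: the composite of the
  restrictions replaces \<open>L (X, Id) = (Y, e)\<close> by \<open>(Y, Id)\<close> before applying \<open>R\<close>.\<close>

definition restrict_incl where
  "restrict_incl C D L R X = underlying (AMap R (retract_incl D (OMap L (embed_obj C X))))"

definition restrict_proj where
  "restrict_proj C D L R X = underlying (AMap R (retract_proj D (OMap L (embed_obj C X))))"

text \<open>Write B for L (X, Id). Retraction after section is the identity of B, and section after
  retraction is the embedded idempotent of B. Applying R gives the values of the two semifunctors at
  the identity of X. Naturality is \<open>embed_underlying\<close> with one retraction
  cancelled.\<close>

lemma inverse_transformations_restrict_comp:
  assumes C: "category C" and D: "category D" and E: "category E"
    and L: "is_functor (completion C) (completion D) L"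
    and R: "is_functor (completion D) (completion E) R"
  shows "inverse_transformations C E (restrict C (R \<odot> L)) (restrict D R \<odot> restrict C L)
    (restrict_incl C D L R) (restrict_proj C D L R)"
proof -
  interpret C: category C by fact
  interpret C': category "completion C" by (rule category_completion[OF C])
  interpret D': category "completion D" by (rule category_completion[OF D])
  interpret E': category "completion E" by (rule category_completion[OF E])
  note A = L[unfolded is_functor_def is_semifunctor_iff[OF category_completion[OF C]]]
    R[unfolded is_functor_def is_semifunctor_iff[OF category_completion[OF D]]]
  note S = embed_simps[OF C] embed_simps[OF D] embed_simps[OF E] retract_simps[OF D]
    underlying_arr[OF E]
  note S' = embed_underlying[OF D] S C.cat_simps D'.cat_simps E'.cat_simps
  have R_comp: "AMap R g \<cdot>\<^bsub>completion E\<^esub> AMap R h = AMap R (g \<cdot>\<^bsub>completion D\<^esub> h)"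
    if "g \<in> Arr (completion D)" "h \<in> Arr (completion D)" "Dom (completion D) g = Cod (completion D) h"
    for g h
    using that A(2) by simp
  \<comment> \<open>The retraction law with a trailing factor, to match composites nested to the
    right.\<close>
  have cancel: "retract_proj D B \<cdot>\<^bsub>completion D\<^esub> (retract_incl D B \<cdot>\<^bsub>completion D\<^esub> f) = f"
    if "B \<in> Obj (completion D)" "f \<in> Arr (completion D)" "Cod (completion D) f = B" for B f
    using that D'.assoc[of f "retract_incl D B" "retract_proj D B"] by (simp add: S D'.ide_simps)
  have "underlying (AMap R (retract_incl D (OMap L (embed_obj C (Cod C f)))) \<cdot>\<^bsub>completion E\<^esub>
        AMap R (AMap L (embed C f))) =
      underlying (AMap R (embed D (underlying (AMap L (embed C f)))) \<cdot>\<^bsub>completion E\<^esub>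
        AMap R (retract_incl D (OMap L (embed_obj C (Dom C f)))))"
    and "underlying (AMap R (retract_proj D (OMap L (embed_obj C (Cod C f)))) \<cdot>\<^bsub>completion E\<^esub>
        AMap R (embed D (underlying (AMap L (embed C f))))) =
      underlying (AMap R (AMap L (embed C f)) \<cdot>\<^bsub>completion E\<^esub>
        AMap R (retract_proj D (OMap L (embed_obj C (Dom C f)))))"
    if f: "f \<in> Arr C" for f
    using A(1) f by (simp_all add: R_comp S' cancel)
  moreover have "underlying (AMap R (retract_proj D (OMap L (embed_obj C X))) \<cdot>\<^bsub>completion E\<^esub>
        AMap R (retract_incl D (OMap L (embed_obj C X)))) =
      underlying (AMap R (AMap L (embed C (Ide C X))))"
    and "underlying (AMap R (retract_incl D (OMap L (embed_obj C X))) \<cdot>\<^bsub>completion E\<^esub>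
        AMap R (retract_proj D (OMap L (embed_obj C X)))) =
      underlying (AMap R (embed D (underlying (AMap L (embed C (Ide C X))))))"
    if X: "X \<in> Obj C" for X
    using A(1) X by (simp_all add: R_comp S' cancel)
  ultimately show ?thesis
    using A
    by (simp add: inverse_transformations_def nat_trans_iff[OF C] restrict_incl_def restrict_proj_def
        underlying_comp[symmetric] S C.cat_simps)
qed

text \<open>Naturality comes from composing with the comparison maps. For the triangle identities
  the computation is lifted to the completions: one retraction pair cancels, naturality carries the
  other correction past \<eta> or \<epsilon>, and the triangle identity there leaves only a section
  or retraction. Its underlying arrow is the idempotent that the restricted functor assigns to
  Id.\<close>

lemma semiadjunction_restrict:
  assumes C: "category C" and D: "category D"
    and adj: "adjunction (completion C) (completion D) L R \<eta> \<epsilon>"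
  shows "semiadjunction C D (restrict C L) (restrict D R)
    (\<lambda>X. restrict_incl C D L R X \<cdot>\<^bsub>C\<^esub> underlying (\<eta> (embed_obj C X)))
    (\<lambda>Y. underlying (\<epsilon> (embed_obj D Y)) \<cdot>\<^bsub>D\<^esub> restrict_proj D C R L Y)"
proof -
  interpret C': category "completion C" by (rule category_completion[OF C])
  interpret D': category "completion D" by (rule category_completion[OF D])
  note adj' = adj[unfolded adjunction_def]
  have L: "is_functor (completion C) (completion D) L" and R: "is_functor (completion D) (completion C) R"
    using adj' by auto
  have Ls: "is_semifunctor C D (restrict C L)" and Rs: "is_semifunctor D C (restrict D R)"
    using L R is_semifunctor_restrict[OF C D] is_semifunctor_restrict[OF D C]
    by (auto simp: is_functor_def)
  have RLs: "is_semifunctor C C (restrict C (R \<odot> L))" and LRs: "is_semifunctor D D (restrict D (L \<odot> R))"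
    using L R is_semifunctor_restrict[OF C C] is_semifunctor_restrict[OF D D]
      is_semifunctor_comp[OF category_completion[OF C] category_completion[OF D], of L "completion C" R]
      is_semifunctor_comp[OF category_completion[OF D] category_completion[OF C], of R "completion D" L]
    by (auto simp: is_functor_def)
  note A = adj'[unfolded is_functor_def is_semifunctor_iff[OF category_completion[OF C]]
      is_semifunctor_iff[OF category_completion[OF D]] nat_trans_iff[OF category_completion[OF C]]
      nat_trans_iff[OF category_completion[OF D]] functor_sel]
  note S = embed_simps[OF C] embed_simps[OF D] retract_simps[OF C] retract_simps[OF D]
    underlying_arr[OF C] underlying_arr[OF D] C'.cat_simps D'.cat_simps
  have "nat_trans C C id_functor (restrict C (R \<odot> L)) (\<lambda>X. underlying (\<eta> (embed_obj C X)))"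
    using nat_trans_restrict[OF C C, of id_functor "R \<odot> L" \<eta>] adj' by simp
  then have \<eta>': "nat_trans C C id_functor (restrict D R \<odot> restrict C L)
      (\<lambda>X. restrict_incl C D L R X \<cdot>\<^bsub>C\<^esub> underlying (\<eta> (embed_obj C X)))"
    using nat_trans_vcomp[OF C C is_semifunctor_id[OF C] RLs is_semifunctor_comp[OF C D Ls Rs]]
      inverse_transformations_restrict_comp[OF C D C L R]
    by (simp add: inverse_transformations_def)
  have "nat_trans D D (restrict D (L \<odot> R)) id_functor (\<lambda>Y. underlying (\<epsilon> (embed_obj D Y)))"
    using nat_trans_restrict[OF D D, of "L \<odot> R" id_functor \<epsilon>] adj' by simp
  then have \<epsilon>': "nat_trans D D (restrict C L \<odot> restrict D R) id_functor
      (\<lambda>Y. underlying (\<epsilon> (embed_obj D Y)) \<cdot>\<^bsub>D\<^esub> restrict_proj D C R L Y)"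
    using nat_trans_vcomp[OF D D is_semifunctor_comp[OF D C Rs Ls] LRs is_semifunctor_id[OF D]]
      inverse_transformations_restrict_comp[OF D C D R L]
    by (simp add: inverse_transformations_def)
  have R_comp: "AMap R g \<cdot>\<^bsub>completion C\<^esub> AMap R h = AMap R (g \<cdot>\<^bsub>completion D\<^esub> h)"
    if "g \<in> Arr (completion D)" "h \<in> Arr (completion D)" "Dom (completion D) g = Cod (completion D) h"
    for g h
    using that A by simp
  have L_comp: "AMap L g \<cdot>\<^bsub>completion D\<^esub> AMap L h = AMap L (g \<cdot>\<^bsub>completion C\<^esub> h)"
    if "g \<in> Arr (completion C)" "h \<in> Arr (completion C)" "Dom (completion C) g = Cod (completion C) h"
    for g h
    using that A by simp
  have "AMap (restrict D R) (underlying (\<epsilon> (embed_obj D Y)) \<cdot>\<^bsub>D\<^esub> restrict_proj D C R L Y) \<cdot>\<^bsub>C\<^esub>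
      (restrict_incl C D L R (OMap (restrict D R) Y) \<cdot>\<^bsub>C\<^esub>
        underlying (\<eta> (embed_obj C (OMap (restrict D R) Y)))) = AMap (restrict D R) (Ide D Y)"
    if Y: "Y \<in> Obj D" for Y
  proof -
    define Y' where "Y' = embed_obj D Y"
    define B where "B = OMap R Y'"
    define X' where "X' = embed_obj C (fst B)"
    define p where "p = retract_proj C B"
    \<comment> \<open>Not an idempotent: \<open>e\<close> lifts the corrected counit component to an
      arrow L X' -> (Y, Id). Its target carries the identity, so re-embedding in
      \<open>embed_e\<close> adds a retraction only at the source.\<close>
    define e where "e = \<epsilon> Y' \<cdot>\<^bsub>completion D\<^esub> AMap L p"
    have obj: "Y' \<in> Obj (completion D)" "B \<in> Obj (completion C)" "X' \<in> Obj (completion C)"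
      "OMap L X' \<in> Obj (completion D)"
      using A Y by (simp_all add: Y'_def B_def X'_def S)
    have p: "p \<in> Arr (completion C)" "Dom (completion C) p = X'" "Cod (completion C) p = B"
      using obj by (simp_all add: p_def X'_def S)
    have \<epsilon>: "\<epsilon> Y' \<in> Arr (completion D)" "Dom (completion D) (\<epsilon> Y') = OMap L B" "Cod (completion D) (\<epsilon> Y') = Y'"
      using A obj by (simp_all add: B_def)
    have Lp: "AMap L p \<in> Arr (completion D)" "Dom (completion D) (AMap L p) = OMap L X'"
      "Cod (completion D) (AMap L p) = OMap L B"
      using A p by simp_all
    have \<eta>: "\<eta> X' \<in> Arr (completion C)" "Dom (completion C) (\<eta> X') = X'"
      "Cod (completion C) (\<eta> X') = OMap R (OMap L X')"
      "\<eta> B \<in> Arr (completion C)" "Dom (completion C) (\<eta> B) = B"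
      "Cod (completion C) (\<eta> B) = OMap R (OMap L B)"
      using A obj by simp_all
    have e: "e \<in> Arr (completion D)" "Dom (completion D) e = OMap L X'" "Cod (completion D) e = Y'"
      using \<epsilon> Lp by (simp_all add: e_def D'.cat_simps)
    let ?i = "retract_incl D (OMap L X')" and ?q = "retract_proj D (OMap L X')"
    have embed_e: "embed D (underlying e) = e \<cdot>\<^bsub>completion D\<^esub> ?q"
      using e obj by (simp add: embed_underlying[OF D] Y'_def S)
    have "AMap R (e \<cdot>\<^bsub>completion D\<^esub> ?q) \<cdot>\<^bsub>completion C\<^esub> (AMap R ?i \<cdot>\<^bsub>completion C\<^esub> \<eta> X') =
        AMap R (e \<cdot>\<^bsub>completion D\<^esub> ?q) \<cdot>\<^bsub>completion C\<^esub> AMap R ?i \<cdot>\<^bsub>completion C\<^esub> \<eta> X'"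
      by (rule C'.assoc[symmetric]) (use A e \<eta> obj in \<open>simp_all add: S\<close>)
    also have "AMap R (e \<cdot>\<^bsub>completion D\<^esub> ?q) \<cdot>\<^bsub>completion C\<^esub> AMap R ?i = AMap R e"
      using e obj by (simp add: R_comp S)
    also have "AMap R e = AMap R (\<epsilon> Y') \<cdot>\<^bsub>completion C\<^esub> AMap R (AMap L p)"
      unfolding e_def using \<epsilon> Lp by (simp add: R_comp)
    also have "\<dots> \<cdot>\<^bsub>completion C\<^esub> \<eta> X' = AMap R (\<epsilon> Y') \<cdot>\<^bsub>completion C\<^esub> (AMap R (AMap L p) \<cdot>\<^bsub>completion C\<^esub> \<eta> X')"
      by (rule C'.assoc) (use A \<epsilon> Lp \<eta> in simp_all)
    \<comment> \<open>Naturality of \<eta> at \<open>p\<close> replaces \<eta> X' by \<eta> B with B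
      = R Y', where the triangle identity at Y' applies.\<close>
    also have "AMap R (AMap L p) \<cdot>\<^bsub>completion C\<^esub> \<eta> X' = \<eta> B \<cdot>\<^bsub>completion C\<^esub> p"
      using A p by metis
    also have "AMap R (\<epsilon> Y') \<cdot>\<^bsub>completion C\<^esub> (\<eta> B \<cdot>\<^bsub>completion C\<^esub> p) =
        AMap R (\<epsilon> Y') \<cdot>\<^bsub>completion C\<^esub> \<eta> B \<cdot>\<^bsub>completion C\<^esub> p"
      by (rule C'.assoc[symmetric]) (use A \<epsilon> \<eta> p in simp_all)
    also have "AMap R (\<epsilon> Y') \<cdot>\<^bsub>completion C\<^esub> \<eta> B = Ide (completion C) B"
      using A obj by (simp add: B_def)
    also have "Ide (completion C) B \<cdot>\<^bsub>completion C\<^esub> p = p"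
      using p by (simp add: C'.ide_simps)
    finally have "underlying (AMap R (embed D (underlying e)) \<cdot>\<^bsub>completion C\<^esub>
        (AMap R ?i \<cdot>\<^bsub>completion C\<^esub> \<eta> X')) = snd B"
      by (simp only: embed_e p_def underlying_simps)
    moreover have "AMap R (embed D (Ide D Y)) = Ide (completion C) B"
      using A Y obj by (simp add: S B_def Y'_def)
    ultimately show ?thesis
      by (simp add: restrict_incl_def restrict_proj_def underlying_comp underlying_simps
          flip: X'_def B_def Y'_def p_def) (simp add: e_def underlying_comp)
  qed
  moreover have "underlying (\<epsilon> (embed_obj D (OMap (restrict C L) X))) \<cdot>\<^bsub>D\<^esub>
      restrict_proj D C R L (OMap (restrict C L) X) \<cdot>\<^bsub>D\<^esub>
      AMap (restrict C L) (restrict_incl C D L R X \<cdot>\<^bsub>C\<^esub> underlying (\<eta> (embed_obj C X))) =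
      AMap (restrict C L) (Ide C X)"
    if X: "X \<in> Obj C" for X
  proof -
    define X' where "X' = embed_obj C X"
    define A' where "A' = OMap L X'"
    define Y' where "Y' = embed_obj D (fst A')"
    define i where "i = retract_incl D A'"
    \<comment> \<open>The lift of the corrected unit component. Here the source is (X, Id), so
      re-embedding adds only the section \<open>?j\<close> at the target.\<close>
    define h where "h = AMap R i \<cdot>\<^bsub>completion C\<^esub> \<eta> X'"
    have obj: "X' \<in> Obj (completion C)" "A' \<in> Obj (completion D)" "Y' \<in> Obj (completion D)"
      "OMap R Y' \<in> Obj (completion C)"
      using A X by (simp_all add: Y'_def A'_def X'_def S)
    have i: "i \<in> Arr (completion D)" "Dom (completion D) i = A'" "Cod (completion D) i = Y'"
      using obj by (simp_all add: i_def Y'_def S)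
    have \<eta>: "\<eta> X' \<in> Arr (completion C)" "Dom (completion C) (\<eta> X') = X'" "Cod (completion C) (\<eta> X') = OMap R A'"
      using A obj by (simp_all add: A'_def)
    have Ri: "AMap R i \<in> Arr (completion C)" "Dom (completion C) (AMap R i) = OMap R A'"
      "Cod (completion C) (AMap R i) = OMap R Y'"
      using A i by simp_all
    have \<epsilon>: "\<epsilon> Y' \<in> Arr (completion D)" "Cod (completion D) (\<epsilon> Y') = Y'"
      "Dom (completion D) (\<epsilon> Y') = OMap L (OMap R Y')"
      "\<epsilon> A' \<in> Arr (completion D)" "Cod (completion D) (\<epsilon> A') = A'"
      "Dom (completion D) (\<epsilon> A') = OMap L (OMap R A')"
      using A obj by simp_all
    have h: "h \<in> Arr (completion C)" "Dom (completion C) h = X'" "Cod (completion C) h = OMap R Y'"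
      using \<eta> Ri by (simp_all add: h_def C'.cat_simps)
    let ?j = "retract_incl C (OMap R Y')" and ?q = "retract_proj C (OMap R Y')"
    have embed_h: "embed C (underlying h) = ?j \<cdot>\<^bsub>completion C\<^esub> h"
      using h obj by (simp add: embed_underlying[OF C] X'_def S)
    have "\<epsilon> Y' \<cdot>\<^bsub>completion D\<^esub> AMap L ?q \<cdot>\<^bsub>completion D\<^esub> AMap L (?j \<cdot>\<^bsub>completion C\<^esub> h) =
        \<epsilon> Y' \<cdot>\<^bsub>completion D\<^esub> (AMap L ?q \<cdot>\<^bsub>completion D\<^esub> AMap L (?j \<cdot>\<^bsub>completion C\<^esub> h))"
      by (rule D'.assoc) (use A \<epsilon> h obj in \<open>simp_all add: S\<close>)
    also have "AMap L ?q \<cdot>\<^bsub>completion D\<^esub> AMap L (?j \<cdot>\<^bsub>completion C\<^esub> h) =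
        AMap L (?q \<cdot>\<^bsub>completion C\<^esub> (?j \<cdot>\<^bsub>completion C\<^esub> h))"
      by (rule L_comp) (use h obj in \<open>simp_all add: S\<close>)
    also have "?q \<cdot>\<^bsub>completion C\<^esub> (?j \<cdot>\<^bsub>completion C\<^esub> h) = ?q \<cdot>\<^bsub>completion C\<^esub> ?j \<cdot>\<^bsub>completion C\<^esub> h"
      by (rule C'.assoc[symmetric]) (use h obj in \<open>simp_all add: S\<close>)
    also have "\<dots> = h"
      using h obj by (simp add: S)
    also have "AMap L h = AMap L (AMap R i) \<cdot>\<^bsub>completion D\<^esub> AMap L (\<eta> X')"
      unfolding h_def using \<eta> Ri by (simp add: L_comp)
    also have "\<epsilon> Y' \<cdot>\<^bsub>completion D\<^esub> \<dots> = \<epsilon> Y' \<cdot>\<^bsub>completion D\<^esub> AMap L (AMap R i) \<cdot>\<^bsub>completion D\<^esub> AMap L (\<eta> X')"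
      by (rule D'.assoc[symmetric]) (use A \<epsilon> \<eta> Ri in simp_all)
    \<comment> \<open>Naturality of \<epsilon> at \<open>i\<close> replaces \<epsilon> Y' by
      \<epsilon> A' with A' = L X', where the triangle identity at X' applies.\<close>
    also have "\<epsilon> Y' \<cdot>\<^bsub>completion D\<^esub> AMap L (AMap R i) = i \<cdot>\<^bsub>completion D\<^esub> \<epsilon> A'"
      using A i by metis
    also have "i \<cdot>\<^bsub>completion D\<^esub> \<epsilon> A' \<cdot>\<^bsub>completion D\<^esub> AMap L (\<eta> X') =
        i \<cdot>\<^bsub>completion D\<^esub> (\<epsilon> A' \<cdot>\<^bsub>completion D\<^esub> AMap L (\<eta> X'))"
      by (rule D'.assoc) (use A \<epsilon> \<eta> i in simp_all)
    also have "\<epsilon> A' \<cdot>\<^bsub>completion D\<^esub> AMap L (\<eta> X') = Ide (completion D) A'"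
      using A obj by (simp add: A'_def)
    also have "i \<cdot>\<^bsub>completion D\<^esub> Ide (completion D) A' = i"
      using i by (simp add: D'.ide_simps)
    finally have "underlying (\<epsilon> Y' \<cdot>\<^bsub>completion D\<^esub> AMap L ?q \<cdot>\<^bsub>completion D\<^esub>
        AMap L (embed C (underlying h))) = snd A'"
      by (simp only: embed_h i_def underlying_simps)
    moreover have "AMap L (embed C (Ide C X)) = Ide (completion D) A'"
      using A X obj by (simp add: S A'_def X'_def)
    ultimately show ?thesis
      by (simp add: restrict_incl_def restrict_proj_def underlying_comp underlying_simps
          flip: X'_def A'_def Y'_def i_def) (simp add: h_def underlying_comp)
  qed
  ultimately show ?thesis
    using Ls Rs \<eta>' \<epsilon>' by (simp add: semiadjunction_def)
qed

section \<open>The characterization\<close>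

lemma coreflection_up_to_retracts_iff:
  assumes C: "category C" and D: "category D" and G: "is_functor D C G"
  shows "coreflection_up_to_retracts D C G \<longleftrightarrow>
    (\<exists>F \<eta> \<epsilon>. semiadjunction C D F G \<eta> \<epsilon> \<and>
      (\<exists>\<nu>. inverse_transformations C C id_functor (G \<odot> F) \<eta> \<nu>))"
proof
  note C' = category_completion[OF C] and D' = category_completion[OF D]
  assume "coreflection_up_to_retracts D C G"
  then obtain L \<eta> \<epsilon> where
    adj: "adjunction (completion C) (completion D) L (functor_completion G) \<eta> \<epsilon>"
    and "fully_faithful (completion C) (completion D) L"
    unfolding coreflection_up_to_retracts_def coreflection_def by blast
  then obtain \<nu> where "inverse_transformations (completion C) (completion C) id_functor
      (functor_completion G \<odot> L) \<eta> \<nu>"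
    by (rule inverse_unit_if_fully_faithful[OF C' D'])
  from inverse_transformations_restrict[OF C C this]
  have "inverse_transformations C C id_functor (restrict C (functor_completion G \<odot> L))
      (\<lambda>X. underlying (\<eta> (embed_obj C X))) (\<lambda>X. underlying (\<nu> (embed_obj C X)))"
    by simp
  moreover note semi = semiadjunction_restrict[OF C D adj, unfolded restrict_functor_completion]
  moreover have functors: "is_functor (completion C) (completion D) L"
    "is_functor (completion D) (completion C) (functor_completion G)"
    using adj by (simp_all add: adjunction_def)
  moreover note inverse_transformations_restrict_comp[OF C D C functors, unfolded restrict_functor_completion]
  moreover have "is_semifunctor C C (restrict C (functor_completion G \<odot> L))"
    using functors is_semifunctor_comp[OF C' D'] is_semifunctor_restrict[OF C C]
    by (auto simp: is_functor_def)
  moreover have "is_semifunctor C C (G \<odot> restrict C L)"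
    using semi is_semifunctor_comp[OF C D] by (auto simp: semiadjunction_def)
  \<comment> \<open>The corrected unit is the restricted unit followed by
    \<open>restrict_incl\<close>. Both factors are invertible, so \<nu> is the restricted inverse
    preceded by \<open>restrict_proj\<close>.\<close>
  ultimately show "\<exists>F \<eta> \<epsilon>. semiadjunction C D F G \<eta> \<epsilon> \<and>
      (\<exists>\<nu>. inverse_transformations C C id_functor (G \<odot> F) \<eta> \<nu>)"
    using inverse_transformations_vcomp[OF C C is_semifunctor_id[OF C]] by blast
next
  note C' = category_completion[OF C] and D' = category_completion[OF D]
  assume "\<exists>F \<eta> \<epsilon>. semiadjunction C D F G \<eta> \<epsilon> \<and>
      (\<exists>\<nu>. inverse_transformations C C id_functor (G \<odot> F) \<eta> \<nu>)"
  then obtain F \<eta> \<epsilon> \<nu> where semi: "semiadjunction C D F G \<eta> \<epsilon>"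
    and inv: "inverse_transformations C C id_functor (G \<odot> F) \<eta> \<nu>" by blast
  note adj = adjunction_completion[OF C D semi]
  have "is_semifunctor C C (G \<odot> F)"
    using semi is_semifunctor_comp[OF C D] by (auto simp: semiadjunction_def)
  from inverse_transformations_completion[OF C C is_semifunctor_id[OF C] this inv]
  have "fully_faithful (completion C) (completion D) (functor_completion F)"
    by (intro fully_faithful_if_inverse_unit[OF C' D' adj]) (simp add: functor_completion_comp)
  with adj G show "coreflection_up_to_retracts D C G"
    unfolding coreflection_up_to_retracts_def coreflection_def adjunction_def by blast
qed

text \<open>The argument is repeated for the counit rather than dualized: arrows of
  \<open>completion (opposite C)\<close> are triples with their ends exchanged, so this category is
  isomorphic but not equal to \<open>opposite (completion C)\<close>.\<close>

lemma reflection_up_to_retracts_iff: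
  assumes C: "category C" and D: "category D" and F: "is_functor C D F"
  shows "reflection_up_to_retracts C D F \<longleftrightarrow>
    (\<exists>G \<eta> \<epsilon>. semiadjunction C D F G \<eta> \<epsilon> \<and>
      (\<exists>\<gamma>. inverse_transformations D D id_functor (F \<odot> G) \<gamma> \<epsilon>))"
proof
  note C' = category_completion[OF C] and D' = category_completion[OF D]
  assume "reflection_up_to_retracts C D F"
  then obtain R \<eta> \<epsilon> where
    adj: "adjunction (completion C) (completion D) (functor_completion F) R \<eta> \<epsilon>"
    and "fully_faithful (completion D) (completion C) R"
    unfolding reflection_up_to_retracts_def reflection_def by blast
  then obtain \<gamma> where "inverse_transformations (completion D) (completion D) id_functor
      (functor_completion F \<odot> R) \<gamma> \<epsilon>"
    by (rule inverse_counit_if_fully_faithful[OF C' D'])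
  from inverse_transformations_restrict[OF D D this]
  have "inverse_transformations D D id_functor (restrict D (functor_completion F \<odot> R))
      (\<lambda>Y. underlying (\<gamma> (embed_obj D Y))) (\<lambda>Y. underlying (\<epsilon> (embed_obj D Y)))"
    by simp
  moreover note semi = semiadjunction_restrict[OF C D adj, unfolded restrict_functor_completion]
  moreover have functors: "is_functor (completion D) (completion C) R"
    "is_functor (completion C) (completion D) (functor_completion F)"
    using adj by (simp_all add: adjunction_def)
  moreover note inverse_transformations_restrict_comp[OF D C D functors, unfolded restrict_functor_completion]
  moreover have "is_semifunctor D D (restrict D (functor_completion F \<odot> R))"
    using functors is_semifunctor_comp[OF D' C'] is_semifunctor_restrict[OF D D]
    by (auto simp: is_functor_def)
  moreover have "is_semifunctor D D (F \<odot> restrict D R)"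
    using semi is_semifunctor_comp[OF D C] by (auto simp: semiadjunction_def)
  ultimately show "\<exists>G \<eta> \<epsilon>. semiadjunction C D F G \<eta> \<epsilon> \<and>
      (\<exists>\<gamma>. inverse_transformations D D id_functor (F \<odot> G) \<gamma> \<epsilon>)"
    using inverse_transformations_vcomp[OF D D is_semifunctor_id[OF D]] by blast
next
  note C' = category_completion[OF C] and D' = category_completion[OF D]
  assume "\<exists>G \<eta> \<epsilon>. semiadjunction C D F G \<eta> \<epsilon> \<and>
      (\<exists>\<gamma>. inverse_transformations D D id_functor (F \<odot> G) \<gamma> \<epsilon>)"
  then obtain G \<eta> \<epsilon> \<gamma> where semi: "semiadjunction C D F G \<eta> \<epsilon>"
    and inv: "inverse_transformations D D id_functor (F \<odot> G) \<gamma> \<epsilon>" by blast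
  note adj = adjunction_completion[OF C D semi]
  have "is_semifunctor D D (F \<odot> G)"
    using semi is_semifunctor_comp[OF D C] by (auto simp: semiadjunction_def)
  from inverse_transformations_completion[OF D D is_semifunctor_id[OF D] this inv]
  have "fully_faithful (completion D) (completion C) (functor_completion G)"
    by (intro fully_faithful_if_inverse_counit[OF C' D' adj]) (simp add: functor_completion_comp)
  with adj F show "reflection_up_to_retracts C D F"
    unfolding reflection_up_to_retracts_def reflection_def adjunction_def by blast
qed

theorem corollary2p18:
  fixes C :: "('o, 'a) category" and D :: "('p, 'b) category"
  assumes "category C" and "category D"
  shows "(\<forall>G. is_functor D C G \<longrightarrow>
      (coreflection_up_to_retracts D C G \<longleftrightarrow>
        (\<exists>F \<eta> \<epsilon>. semiadjunction C D F G \<eta> \<epsilon> \<and>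
          (\<exists>\<nu>. nat_trans C C (G \<odot> F) id_functor \<nu> \<and>
            (\<forall>X \<in> Obj C. \<eta> X \<cdot>\<^bsub>C\<^esub> \<nu> X = AMap (G \<odot> F) (Ide C X)) \<and>
            (\<forall>X \<in> Obj C. \<nu> X \<cdot>\<^bsub>C\<^esub> \<eta> X = Ide C X))))) \<and>
    (\<forall>F. is_functor C D F \<longrightarrow>
      (reflection_up_to_retracts C D F \<longleftrightarrow>
        (\<exists>G \<eta> \<epsilon>. semiadjunction C D F G \<eta> \<epsilon> \<and>
          (\<exists>\<gamma>. nat_trans D D id_functor (F \<odot> G) \<gamma> \<and>
            (\<forall>Y \<in> Obj D. \<gamma> Y \<cdot>\<^bsub>D\<^esub> \<epsilon> Y = AMap (F \<odot> G) (Ide D Y)) \<and>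
            (\<forall>Y \<in> Obj D. \<epsilon> Y \<cdot>\<^bsub>D\<^esub> \<gamma> Y = Ide D Y)))))"
proof -
  \<comment> \<open>Naturality of \<eta> is already part of the semiadjunction, and
    \<open>id_functor\<close> fixes identities; this reduces \<open>inverse_transformations\<close>
    to the three conditions on \<nu>.\<close>
  have "(semiadjunction C D F G \<eta> \<epsilon> \<and> (\<exists>\<nu>. inverse_transformations C C id_functor (G \<odot> F) \<eta> \<nu>)) \<longleftrightarrow>
    (semiadjunction C D F G \<eta> \<epsilon> \<and> (\<exists>\<nu>. nat_trans C C (G \<odot> F) id_functor \<nu> \<and>
      (\<forall>X \<in> Obj C. \<eta> X \<cdot>\<^bsub>C\<^esub> \<nu> X = AMap (G \<odot> F) (Ide C X)) \<and>
      (\<forall>X \<in> Obj C. \<nu> X \<cdot>\<^bsub>C\<^esub> \<eta> X = Ide C X)))" for F G \<eta> \<epsilon>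
    by (auto simp: inverse_transformations_def semiadjunction_def)
  moreover have "(semiadjunction C D F G \<eta> \<epsilon> \<and> (\<exists>\<gamma>. inverse_transformations D D id_functor (F \<odot> G) \<gamma> \<epsilon>)) \<longleftrightarrow>
    (semiadjunction C D F G \<eta> \<epsilon> \<and> (\<exists>\<gamma>. nat_trans D D id_functor (F \<odot> G) \<gamma> \<and>
      (\<forall>Y \<in> Obj D. \<gamma> Y \<cdot>\<^bsub>D\<^esub> \<epsilon> Y = AMap (F \<odot> G) (Ide D Y)) \<and>
      (\<forall>Y \<in> Obj D. \<epsilon> Y \<cdot>\<^bsub>D\<^esub> \<gamma> Y = Ide D Y)))" for F G \<eta> \<epsilon>
    by (auto simp: inverse_transformations_def semiadjunction_def)
  ultimately show ?thesis
    by (simp only: coreflection_up_to_retracts_iff[OF assms] reflection_up_to_retracts_iff[OF assms]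
        simp_thms cong: imp_cong)
qed

end
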